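(* Let $\Phi$ be a uniformly absolutely convergent interaction on $X=E^{\mathbb{Z}}$ ($E$ finite) satisfying the Dobrushin condition $\bar c(\Phi)<1$. Then $\bar c(\Psi^{(k)})<1$ for all $k\ge0$, and for each $k$ the unique Gibbs measure $\nu^{(k)}$ of $\Psi^{(k)}$ is equivalent to the unique Gibbs measure $\nu^{(0)}$ of $\Psi^{(0)}$, with $$\frac{d\nu^{(k)}}{d\nu^{(0)}}=\frac{e^{-\sum_{i=1}^k\Phi_{\Lambda_i}}}{\int_Xe^{-\sum_{i=1}^k\Phi_{\Lambda_i}}d\nu^{(0)}},\qquad\frac{d\nu^{(0)}}{d\nu^{(k)}}=\frac{e^{\sum_{i=1}^k\Phi_{\Lambda_i}}}{\int_Xe^{\sum_{i=1}^k\Phi_{\Lambda_i}}d\nu^{(k)}}.$$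
   Context: An interaction $\Phi=(\Phi_\Lambda)_{\Lambda\Subset\mathbb{Z}}$ consists of functions $\Phi_\Lambda$ on $X$ depending only on coordinates in $\Lambda$; UAC means $\sup_i\sum_{V\ni i}\|\Phi_V\|_\infty<\infty$. Its Gibbs measures are the probabilities consistent with $\gamma^\Phi_\Lambda(\omega_\Lambda|\eta_{\Lambda^c})=e^{-H^\Phi_\Lambda(\omega_\Lambda\eta_{\Lambda^c})}/\sum_{\bar\omega_\Lambda}e^{-H^\Phi_\Lambda(\bar\omega_\Lambda\eta_{\Lambda^c})}$, $H^\Phi_\Lambda=\sum_{V\cap\Lambda\neq\emptyset}\Phi_V$. Dobrushin condition: $\bar c(\Phi):=\frac12\sup_{i}\sum_{\Lambda\ni i}(|\Lambda|-1)\delta(\Phi_\Lambda)<1$ with $\delta(f)=\sup_{\xi,\eta}|f(\xi)-f(\eta)|$; it implies uniqueness of the Gibbs measure. Let $\mathcal A=\{\Lambda\Subset\mathbb{Z}:\min\Lambda<0\le\max\Lambda\}$, enumerated in an arbitrary fixed order as $\Lambda_1,\Lambda_2,\dots$. For $k\ge0$, $\Psi^{(k)}_\Lambda=0$ if $\Lambda\in\{\Lambda_i:i\ge k+1\}$ and $\Psi^{(k)}_\Lambda=\Phi_\Lambda$ otherwise. *)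

theory Defs
  imports "HOL-Probability.Probability"
begin

definition XM :: "(int \<Rightarrow> 'e::finite) measure" where
  "XM = PiM UNIV (\<lambda>_. count_space UNIV)"

definition is_interaction :: "(int set \<Rightarrow> (int \<Rightarrow> 'e) \<Rightarrow> real) \<Rightarrow> bool" where
  "is_interaction Phi \<longleftrightarrow>
     (\<forall>L. finite L \<longrightarrow> (\<forall>\<xi> \<eta>. (\<forall>i\<in>L. \<xi> i = \<eta> i) \<longrightarrow> Phi L \<xi> = Phi L \<eta>))"

definition supnorm :: "('a \<Rightarrow> real) \<Rightarrow> real" where
  "supnorm f = (SUP x. \<bar>f x\<bar>)"

definition osc :: "('a \<Rightarrow> real) \<Rightarrow> real" where
  "osc f = (SUP p. \<bar>f (fst p) - f (snd p)\<bar>)"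

definition uac :: "(int set \<Rightarrow> (int \<Rightarrow> 'e) \<Rightarrow> real) \<Rightarrow> bool" where
  "uac Phi \<longleftrightarrow> (\<exists>C. \<forall>i::int.
      (\<lambda>V. supnorm (Phi V)) summable_on {V. finite V \<and> i \<in> V} \<and>
      (\<Sum>\<^sub>\<infinity>V\<in>{V. finite V \<and> i \<in> V}. supnorm (Phi V)) \<le> C)"

text \<open>Dobrushin constant (valued in ennreal, since the sums may diverge).\<close>
definition dobrushin :: "(int set \<Rightarrow> (int \<Rightarrow> 'e) \<Rightarrow> real) \<Rightarrow> ennreal" where
  "dobrushin Phi = ennreal (1/2) *
     (SUP i::int. (\<Sum>\<^sub>\<infinity>L\<in>{L. finite L \<and> i \<in> L}.
                    ennreal ((real (card L) - 1) * osc (Phi L))))"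

definition hamiltonian :: "(int set \<Rightarrow> (int \<Rightarrow> 'e) \<Rightarrow> real) \<Rightarrow> int set \<Rightarrow> (int \<Rightarrow> 'e) \<Rightarrow> real" where
  "hamiltonian Phi L \<omega> = (\<Sum>\<^sub>\<infinity>V\<in>{V. finite V \<and> V \<inter> L \<noteq> {}}. Phi V \<omega>)"

definition local_conf :: "int set \<Rightarrow> (int \<Rightarrow> 'e) set" where
  "local_conf L = PiE L (\<lambda>_. UNIV)"

definition merge_conf :: "int set \<Rightarrow> (int \<Rightarrow> 'e) \<Rightarrow> (int \<Rightarrow> 'e) \<Rightarrow> (int \<Rightarrow> 'e)" where
  "merge_conf L \<sigma> \<eta> = (\<lambda>i. if i \<in> L then \<sigma> i else \<eta> i)"

definition gibbs_spec :: "(int set \<Rightarrow> (int \<Rightarrow> 'e) \<Rightarrow> real) \<Rightarrow> int set \<Rightarrow> (int \<Rightarrow> 'e) \<Rightarrow> (int \<Rightarrow> 'e) \<Rightarrow> real" where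
  "gibbs_spec Phi L \<sigma> \<eta> =
     exp (- hamiltonian Phi L (merge_conf L \<sigma> \<eta>)) /
     (\<Sum>\<tau>\<in>local_conf L. exp (- hamiltonian Phi L (merge_conf L \<tau> \<eta>)))"

definition is_gibbs :: "(int set \<Rightarrow> (int \<Rightarrow> 'e::finite) \<Rightarrow> real) \<Rightarrow> (int \<Rightarrow> 'e) measure \<Rightarrow> bool" where
  "is_gibbs Phi \<mu> \<longleftrightarrow> prob_space \<mu> \<and> sets \<mu> = sets XM \<and>
     (\<forall>L. finite L \<longrightarrow> (\<forall>A\<in>sets XM.
        measure \<mu> A = (\<integral>\<eta>. (\<Sum>\<sigma>\<in>local_conf L. gibbs_spec Phi L \<sigma> \<eta> * indicator A (merge_conf L \<sigma> \<eta>)) \<partial>\<mu>)))"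

definition crossing_sets :: "int set set" where
  "crossing_sets = {L. finite L \<and> L \<noteq> {} \<and> Min L < 0 \<and> 0 \<le> Max L}"

text \<open>Psi^(k): drop Phi_{Lambda_i} for i >= k+1 (Lam enumerates crossing_sets from index 1).\<close>
definition Psi :: "(int set \<Rightarrow> (int \<Rightarrow> 'e) \<Rightarrow> real) \<Rightarrow> (nat \<Rightarrow> int set) \<Rightarrow> nat \<Rightarrow> int set \<Rightarrow> (int \<Rightarrow> 'e) \<Rightarrow> real" where
  "Psi Phi Lam k L = (if L \<in> Lam ` {k+1..} then (\<lambda>_. 0) else Phi L)"

end

theory Submission
  imports Defs
begin

text \<open>
  Dropping finitely many local terms \<open>W = (\<Sum>i=1..k. Phi (Lam i))\<close> changes every Hamiltonian by \<open>W\<close>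
  up to a term not depending on the inner configuration. Hence tilting a Gibbs measure of
  \<open>Psi Phi Lam 0\<close> by \<open>exp (- W)\<close> gives a Gibbs measure of \<open>Psi Phi Lam k\<close>, and the density formula
  follows from uniqueness of the latter.

  Uniqueness is Dobrushin's argument: if two Gibbs measures satisfy
  \<open>\<bar>\<mu> f - \<nu> f\<bar> \<le> (\<Sum>j. a j * \<delta>\<^sub>j f)\<close> for all quasilocal \<open>f\<close>, where \<open>\<delta>\<^sub>j f\<close> is the oscillation of
  \<open>f\<close> at site \<open>j\<close>, then averaging over the spin at \<open>i\<close> improves \<open>a i\<close> to \<open>(\<Sum>j\<noteq>i. C i j * a j)\<close>
  with \<open>C i j = (\<Sum>V\<ni>i,j. osc (Phi V)) / 2\<close>. The row sums of \<open>C\<close> are bounded by the Dobrushin constant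
  \<open>c < 1\<close>, so starting from \<open>a = 1\<close> one may take \<open>a = c ^ n\<close> for every \<open>n\<close>.
\<close>

subsection \<open>Means under finite Boltzmann weights\<close>

text \<open>Since \<open>Phi\<close> may have infinite range, averaging a local function over one
  spin need not give a local function. Quasilocal functions are stable under this averaging, hence
  they are the test class. On the other hand, only finitely many sites can be updated one after
  another; a gain at all sites at once comes from testing on local functions, for which weights
  outside a finite set multiply oscillation zero. Oscillations of a quasilocal function need not be
  summable, so the estimates live in \<open>ennreal\<close>, where an infinite bound is harmless and
  sums over sites and over sets can be swapped by Tonelli. The factor \<open>1/2\<close> in
  \<open>dobrushin\<close> is reached because a variable with range of length \<open>D\<close> has
  standard deviation at most \<open>D / 2\<close>. For the tilting, a restored set
  \<open>Lam i\<close> that meets \<open>L\<close> enters both the Hamiltonian difference and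
  \<open>W\<close>; one that misses \<open>L\<close> enters only \<open>W\<close>, but it depends on
  the exterior configuration alone and cancels on normalisation. Uniqueness is needed for
  \<open>Psi Phi Lam k\<close> only, because the second density is obtained by inverting the
  first.\<close>

lemma weighted_covariance_bound:
  fixes p h G :: "'s \<Rightarrow> real"
  assumes p: "\<And>s. s \<in> \<Omega> \<Longrightarrow> 0 \<le> p s" "sum p \<Omega> = 1"
    and h: "\<And>s. s \<in> \<Omega> \<Longrightarrow> \<bar>h s\<bar> \<le> e"
    and G: "\<And>s t. s \<in> \<Omega> \<Longrightarrow> t \<in> \<Omega> \<Longrightarrow> \<bar>G s - G t\<bar> \<le> D"
  shows "\<bar>(\<Sum>s\<in>\<Omega>. p s * h s * G s) - (\<Sum>s\<in>\<Omega>. p s * h s) * (\<Sum>s\<in>\<Omega>. p s * G s)\<bar> \<le> D * e / 2"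
proof -
  have fin: "finite \<Omega>"
    using p(2) sum.infinite[of \<Omega> p] by fastforce
  have ne: "\<Omega> \<noteq> {}"
    using p(2) by auto
  \<comment> \<open>The midpoint of the range of \<open>G\<close> is within \<open>D / 2\<close> of
    every value; this is the origin of the factor \<open>1/2\<close>.\<close>
  define m where "m = (Max (G ` \<Omega>) + Min (G ` \<Omega>)) / 2"
  have m: "\<bar>G s - m\<bar> \<le> D / 2" if "s \<in> \<Omega>" for s
  proof -
    have "Max (G ` \<Omega>) \<in> G ` \<Omega>"
      using fin ne by (intro Max_in) auto
    then obtain a where a: "a \<in> \<Omega>" "Max (G ` \<Omega>) = G a" by blast
    have "Min (G ` \<Omega>) \<in> G ` \<Omega>"
      using fin ne by (intro Min_in) auto
    then obtain b where b: "b \<in> \<Omega>" "Min (G ` \<Omega>) = G b" by blast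
    have "G s \<le> G a" "G b \<le> G s"
      using Max_ge[of "G ` \<Omega>" "G s"] Min_le[of "G ` \<Omega>" "G s"] fin that a b by auto
    moreover have "G a - G b \<le> D" using G[OF a(1) b(1)] by simp
    ultimately have "G s - (G a + G b) / 2 \<le> D / 2" "- (G s - (G a + G b) / 2) \<le> D / 2"
      by (simp_all add: field_simps)
    then show ?thesis unfolding m_def a(2) b(2) by (rule abs_leI)
  qed
  define g where "g = (\<Sum>s\<in>\<Omega>. p s * G s)"
  define Y where "Y s = \<bar>G s - g\<bar>" for s
  define y where "y = (\<Sum>s\<in>\<Omega>. p s * Y s)"
  have D0: "0 \<le> D"
    using ne G abs_ge_zero order_trans by blast
  have e0: "0 \<le> e"
    using ne h abs_ge_zero order_trans by blast
  have sump: "(\<Sum>s\<in>\<Omega>. p s * c) = c" for c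
    by (simp add: sum_distrib_right[symmetric] p(2))
  \<comment> \<open>Jensen bounds the squared mean deviation by the variance, and the variance is
    the second moment about \<open>m\<close> minus \<open>(g - m)\<close> squared. This is
    Popoviciu's inequality: the variance is at most \<open>D / 2\<close> squared.\<close>
  have "y\<^sup>2 \<le> (\<Sum>s\<in>\<Omega>. p s * (Y s)\<^sup>2)"
  proof -
    have "0 \<le> (\<Sum>s\<in>\<Omega>. p s * (Y s - y)\<^sup>2)"
      by (intro sum_nonneg mult_nonneg_nonneg p) auto
    also have "\<dots> = (\<Sum>s\<in>\<Omega>. p s * (Y s)\<^sup>2 - 2 * y * (p s * Y s) + p s * y\<^sup>2)"
      by (intro sum.cong) (auto simp: power2_eq_square algebra_simps)
    also have "\<dots> = (\<Sum>s\<in>\<Omega>. p s * (Y s)\<^sup>2) - 2 * y * y + y\<^sup>2"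
      by (simp add: sum.distrib sum_subtractf sum_distrib_left[symmetric] y_def[symmetric] sump)
    finally show ?thesis by (simp add: power2_eq_square)
  qed
  also have "\<dots> = (\<Sum>s\<in>\<Omega>. p s * (G s - m)\<^sup>2) - (g - m)\<^sup>2"
  proof -
    have "(\<Sum>s\<in>\<Omega>. p s * (Y s)\<^sup>2) =
        (\<Sum>s\<in>\<Omega>. p s * (G s - m)\<^sup>2 - 2 * (g - m) * (p s * G s) + p s * (g\<^sup>2 - m\<^sup>2))"
      unfolding Y_def by (intro sum.cong) (auto simp: power2_eq_square algebra_simps)
    also have "\<dots> = (\<Sum>s\<in>\<Omega>. p s * (G s - m)\<^sup>2) - 2 * (g - m) * g + (g\<^sup>2 - m\<^sup>2)"
      by (simp add: sum.distrib sum_subtractf sum_distrib_left[symmetric] g_def[symmetric] sump)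
    finally show ?thesis by (simp add: power2_eq_square algebra_simps)
  qed
  also have "\<dots> \<le> (\<Sum>s\<in>\<Omega>. p s * (G s - m)\<^sup>2)" by simp
  also have "\<dots> \<le> (\<Sum>s\<in>\<Omega>. p s * (D / 2)\<^sup>2)"
  proof (intro sum_mono mult_left_mono p)
    fix s assume "s \<in> \<Omega>"
    then show "(G s - m)\<^sup>2 \<le> (D / 2)\<^sup>2"
      using m[of s] D0 abs_le_square_iff[of "G s - m" "D / 2"] by simp
  qed
  finally have "y\<^sup>2 \<le> (D / 2)\<^sup>2" unfolding sump .
  then have y: "y \<le> D / 2"
    by (rule power2_le_imp_le) (use D0 in simp)
  \<comment> \<open>Centring \<open>G\<close> alone does not change the covariance, so the bound on
    \<open>h\<close> need only be paired with the mean absolute deviation of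
    \<open>G\<close>.\<close>
  have "(\<Sum>s\<in>\<Omega>. p s * h s * G s) - (\<Sum>s\<in>\<Omega>. p s * h s) * g = (\<Sum>s\<in>\<Omega>. p s * h s * (G s - g))"
    by (simp add: sum_subtractf sum_distrib_right right_diff_distrib)
  also have "\<bar>\<dots>\<bar> \<le> (\<Sum>s\<in>\<Omega>. \<bar>p s * h s * (G s - g)\<bar>)" by (rule sum_abs)
  also have "\<dots> \<le> (\<Sum>s\<in>\<Omega>. e * (p s * Y s))"
  proof (intro sum_mono)
    fix s assume s: "s \<in> \<Omega>"
    have "\<bar>p s * h s * (G s - g)\<bar> = p s * Y s * \<bar>h s\<bar>"
      using p(1)[OF s] by (simp add: abs_mult Y_def)
    also have "\<dots> \<le> p s * Y s * e"
      using p(1)[OF s] h[OF s] by (intro mult_left_mono) (auto simp: Y_def)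
    finally show "\<bar>p s * h s * (G s - g)\<bar> \<le> e * (p s * Y s)" by (simp add: mult_ac)
  qed
  also have "\<dots> = e * y" by (simp add: y_def sum_distrib_left)
  also have "\<dots> \<le> e * (D / 2)" using y e0 by (rule mult_left_mono)
  finally show ?thesis by (simp add: g_def mult_ac)
qed

text \<open>Along the linear interpolation from \<open>v\<close> to \<open>u\<close> the derivative of the mean of \<open>G\<close> is a
  covariance. The constant \<open>1/2\<close> is sharp enough to give uniqueness up to Dobrushin constant \<open>1\<close>.\<close>

lemma exp_average_diff:
  fixes u v F G :: "'s \<Rightarrow> real"
  assumes fin: "finite \<Omega>" and ne: "\<Omega> \<noteq> {}"
    and uv: "\<And>s. s \<in> \<Omega> \<Longrightarrow> \<bar>u s - v s\<bar> \<le> e"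
    and FG: "\<And>s. s \<in> \<Omega> \<Longrightarrow> \<bar>F s - G s\<bar> \<le> d"
    and G: "\<And>s t. s \<in> \<Omega> \<Longrightarrow> t \<in> \<Omega> \<Longrightarrow> \<bar>G s - G t\<bar> \<le> D"
  shows "\<bar>(\<Sum>s\<in>\<Omega>. exp (- u s) / (\<Sum>t\<in>\<Omega>. exp (- u t)) * F s) -
          (\<Sum>s\<in>\<Omega>. exp (- v s) / (\<Sum>t\<in>\<Omega>. exp (- v t)) * G s)\<bar> \<le> d + D * e / 2"
proof -
  have pos: "(\<Sum>t\<in>\<Omega>. exp (w t :: real)) > 0" for w
    using fin ne by (intro sum_pos) auto
  define w where "w t s = exp (- (v s + t * (u s - v s)))" for t s
  define N where "N t = (\<Sum>s\<in>\<Omega>. w t s * G s)" for t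
  define Z where "Z t = (\<Sum>s\<in>\<Omega>. w t s)" for t
  define N' where "N' t = (\<Sum>s\<in>\<Omega>. - (w t s * (u s - v s) * G s))" for t
  define Z' where "Z' t = (\<Sum>s\<in>\<Omega>. - (w t s * (u s - v s)))" for t
  have Zpos: "Z t > 0" for t unfolding Z_def w_def by (rule pos)
  have dw: "DERIV (\<lambda>t. w t s) t :> - (w t s * (u s - v s))" for t s
    unfolding w_def by (auto intro!: derivative_eq_intros simp: algebra_simps)
  have dN: "DERIV N t :> N' t" for t
    unfolding N_def N'_def by (auto intro!: derivative_eq_intros dw)
  have dZ: "DERIV Z t :> Z' t" for t
    unfolding Z_def Z'_def by (auto intro!: derivative_eq_intros dw)
  have d: "DERIV (\<lambda>t. N t / Z t) t :> (N' t * Z t - N t * Z' t) / (Z t * Z t)" for t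
    using Zpos[of t] by (intro DERIV_divide dN dZ) auto
  have bound: "\<bar>(N' t * Z t - N t * Z' t) / (Z t * Z t)\<bar> \<le> D * e / 2" for t
  proof -
    define p where "p s = w t s / Z t" for s
    have "\<bar>(\<Sum>s\<in>\<Omega>. p s * (u s - v s) * G s) - (\<Sum>s\<in>\<Omega>. p s * (u s - v s)) * (\<Sum>s\<in>\<Omega>. p s * G s)\<bar> \<le> D * e / 2"
    proof (rule weighted_covariance_bound)
      show "0 \<le> p s" for s using Zpos[of t] by (simp add: p_def w_def)
      show "sum p \<Omega> = 1"
        unfolding p_def sum_divide_distrib[symmetric] using Zpos[of t] by (simp add: Z_def)
    qed (use uv G in auto)
    moreover have "(N' t * Z t - N t * Z' t) / (Z t * Z t) =
        - ((\<Sum>s\<in>\<Omega>. p s * (u s - v s) * G s) - (\<Sum>s\<in>\<Omega>. p s * (u s - v s)) * (\<Sum>s\<in>\<Omega>. p s * G s))"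
    proof -
      have 1: "(\<Sum>s\<in>\<Omega>. p s * (u s - v s) * G s) = - N' t / Z t"
        unfolding N'_def p_def by (simp add: sum_divide_distrib sum_negf)
      have 2: "(\<Sum>s\<in>\<Omega>. p s * (u s - v s)) = - Z' t / Z t"
        unfolding Z'_def p_def by (simp add: sum_divide_distrib sum_negf)
      have 3: "(\<Sum>s\<in>\<Omega>. p s * G s) = N t / Z t"
        unfolding N_def p_def by (simp add: sum_divide_distrib)
      show ?thesis unfolding 1 2 3 using Zpos[of t] by (simp add: divide_simps)
    qed
    ultimately show ?thesis by (simp only: abs_minus_cancel)
  qed
  obtain z where "N 1 / Z 1 - N 0 / Z 0 = (1 - 0) * ((N' z * Z z - N z * Z' z) / (Z z * Z z))"
    using MVT2[of 0 1 "\<lambda>t. N t / Z t" "\<lambda>t. (N' t * Z t - N t * Z' t) / (Z t * Z t)"] d by auto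
  with bound[of z] have A: "\<bar>N 1 / Z 1 - N 0 / Z 0\<bar> \<le> D * e / 2" by simp
  have N1: "(\<Sum>s\<in>\<Omega>. exp (- u s) / (\<Sum>t\<in>\<Omega>. exp (- u t)) * G s) = N 1 / Z 1"
    unfolding N_def Z_def w_def by (simp add: sum_divide_distrib)
  have N0: "(\<Sum>s\<in>\<Omega>. exp (- v s) / (\<Sum>t\<in>\<Omega>. exp (- v t)) * G s) = N 0 / Z 0"
    unfolding N_def Z_def w_def by (simp add: sum_divide_distrib)
  \<comment> \<open>The function is exchanged first, under the fixed probability weights of
    \<open>u\<close>, at cost \<open>d\<close>. The change of weights is then charged to
    \<open>G\<close> alone, so only the oscillation of \<open>G\<close> is needed.\<close>
  have "\<bar>(\<Sum>s\<in>\<Omega>. exp (- u s) / (\<Sum>t\<in>\<Omega>. exp (- u t)) * F s) - N 1 / Z 1\<bar> =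
      \<bar>\<Sum>s\<in>\<Omega>. exp (- u s) / (\<Sum>t\<in>\<Omega>. exp (- u t)) * (F s - G s)\<bar>"
    unfolding N1[symmetric] by (simp add: sum_subtractf right_diff_distrib)
  also have "\<dots> \<le> (\<Sum>s\<in>\<Omega>. \<bar>exp (- u s) / (\<Sum>t\<in>\<Omega>. exp (- u t)) * (F s - G s)\<bar>)"
    by (rule sum_abs)
  also have "\<dots> \<le> (\<Sum>s\<in>\<Omega>. exp (- u s) / (\<Sum>t\<in>\<Omega>. exp (- u t)) * d)"
  proof (intro sum_mono)
    fix s assume "s \<in> \<Omega>"
    then show "\<bar>exp (- u s) / (\<Sum>t\<in>\<Omega>. exp (- u t)) * (F s - G s)\<bar>
        \<le> exp (- u s) / (\<Sum>t\<in>\<Omega>. exp (- u t)) * d"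
      unfolding abs_mult using FG[of s] pos[of "\<lambda>s. - u s"]
      by (intro mult_mono) auto
  qed
  also have "\<dots> = d"
    using pos[of "\<lambda>s. - u s"]
    by (simp add: sum_distrib_right[symmetric] sum_divide_distrib[symmetric])
  finally show ?thesis using A unfolding N0 by linarith
qed

subsection \<open>Local and quasilocal observables\<close>

lemma finite_local_conf: "finite L \<Longrightarrow> finite (local_conf L :: (int \<Rightarrow> 'e::finite) set)"
  by (simp add: local_conf_def finite_PiE)

lemma restrict_in_local_conf: "restrict x L \<in> local_conf L"
  by (simp add: local_conf_def)

lemma local_conf_nonempty: "local_conf L \<noteq> {}"
  using restrict_in_local_conf by blast

lemma merge_conf_in [simp]: "i \<in> L \<Longrightarrow> merge_conf L \<sigma> x i = \<sigma> i"
  and merge_conf_notin [simp]: "i \<notin> L \<Longrightarrow> merge_conf L \<sigma> x i = x i"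
  by (auto simp: merge_conf_def)

lemma merge_conf_merge_conf [simp]: "merge_conf L \<sigma> (merge_conf L \<tau> x) = merge_conf L \<sigma> x"
  by (auto simp: merge_conf_def)

lemma space_XM [simp]: "space XM = UNIV"
  by (auto simp: XM_def space_PiM PiE_def extensional_def)

lemma merge_conf_measurable [measurable]: "merge_conf L \<sigma> \<in> measurable XM XM"
  unfolding XM_def merge_conf_def
  by (rule measurable_PiM_single') (auto intro!: measurable_If)

definition depends_on :: "int set \<Rightarrow> ((int \<Rightarrow> 'e) \<Rightarrow> 'b) \<Rightarrow> bool" where
  "depends_on S f \<longleftrightarrow> (\<forall>x y. (\<forall>i\<in>S. x i = y i) \<longrightarrow> f x = f y)"

lemma depends_onD: "depends_on S f \<Longrightarrow> (\<And>i. i \<in> S \<Longrightarrow> x i = y i) \<Longrightarrow> f x = f y"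
  by (auto simp: depends_on_def)

lemma depends_on_restrict: "depends_on S f \<Longrightarrow> f (restrict x S) = f x"
  by (rule depends_onD) auto

lemma depends_on_truncate: "depends_on S (\<lambda>x. f (restrict x S))"
  unfolding depends_on_def
proof (intro allI impI)
  fix x y :: "int \<Rightarrow> 'a" assume "\<forall>i\<in>S. x i = y i"
  then have "restrict x S = restrict y S" by auto
  then show "f (restrict x S) = f (restrict y S)" by simp
qed

text \<open>Restriction sends all coordinates off \<open>S\<close> to \<open>undefined\<close>,
  which turns any configuration into an element of \<open>local_conf S\<close> without changing the
  value of \<open>f\<close>.\<close>

lemma depends_on_range:
  assumes "depends_on S f" shows "range f = f ` local_conf S"
proof -
  have "f x \<in> f ` local_conf S" for x
    using imageI[OF restrict_in_local_conf[of x S], of f] unfolding depends_on_restrict[OF assms] .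
  then show ?thesis by (intro equalityI image_subsetI image_mono subset_UNIV)
qed

lemma depends_on_finite_range:
  fixes f :: "(int \<Rightarrow> 'e::finite) \<Rightarrow> 'b"
  assumes "depends_on S f" "finite S" shows "finite (range f)"
  unfolding depends_on_range[OF assms(1)] by (intro finite_imageI finite_local_conf assms(2))

text \<open>\<open>f\<close> factors through the finite product over \<open>S\<close>, whose product
  sigma-algebra is discrete.\<close>

lemma depends_on_measurable:
  fixes f :: "(int \<Rightarrow> 'e::finite) \<Rightarrow> real"
  assumes "depends_on S f" "finite S"
  shows "f \<in> borel_measurable XM"
proof -
  have "(\<lambda>x. restrict x S) \<in> measurable XM (PiM S (\<lambda>_. count_space (UNIV :: 'e set)))"
    unfolding XM_def by (rule measurable_restrict_subset) simp
  moreover have "f \<in> borel_measurable (PiM S (\<lambda>_. count_space (UNIV :: 'e set)))"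
    using count_space_PiM_finite[of S "\<lambda>_. UNIV :: 'e set"] assms(2)
    by (simp add: measurable_cong_sets[OF _ refl] measurable_def)
  ultimately have "(\<lambda>x. f (restrict x S)) \<in> borel_measurable XM"
    by (rule measurable_compose)
  then show ?thesis unfolding depends_on_restrict[OF assms(1)] .
qed

text \<open>Uniform continuity for the product uniformity; over a finite alphabet it is the same as
  continuity, by compactness. The uniform form gives boundedness and uniform truncation
  directly.\<close>

definition quasilocal :: "((int \<Rightarrow> 'e) \<Rightarrow> real) \<Rightarrow> bool" where
  "quasilocal f \<longleftrightarrow>
     (\<forall>e>0. \<exists>S. finite S \<and> (\<forall>x y. (\<forall>i\<in>S. x i = y i) \<longrightarrow> \<bar>f x - f y\<bar> \<le> e))"

lemma quasilocalD:
  assumes "quasilocal f" "e > 0"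
  obtains S where "finite S" "\<And>x y. (\<And>i. i \<in> S \<Longrightarrow> x i = y i) \<Longrightarrow> \<bar>f x - f y\<bar> \<le> e"
proof -
  obtain S where "finite S" "\<forall>x y. (\<forall>i\<in>S. x i = y i) \<longrightarrow> \<bar>f x - f y\<bar> \<le> e"
    using assms unfolding quasilocal_def by metis
  then show ?thesis by (intro that[of S]) auto
qed

lemma quasilocalI:
  assumes "\<And>e. e > 0 \<Longrightarrow> \<exists>S. finite S \<and> (\<forall>x y. (\<forall>i\<in>S. x i = y i) \<longrightarrow> \<bar>f x - f y\<bar> \<le> e)"
  shows "quasilocal f"
  using assms unfolding quasilocal_def by blast

lemma depends_on_quasilocal:
  assumes "depends_on S f" "finite S" shows "quasilocal f"
proof (rule quasilocalI)
  fix e :: real assume e: "e > 0"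
  have "\<bar>f x - f y\<bar> \<le> e" if "\<forall>i\<in>S. x i = y i" for x y
    using depends_onD[OF assms(1), of x y] that e by simp
  then show "\<exists>S. finite S \<and> (\<forall>x y. (\<forall>i\<in>S. x i = y i) \<longrightarrow> \<bar>f x - f y\<bar> \<le> e)"
    using assms(2) by blast
qed

text \<open>Truncation to a finite set, accurate to within 1, leaves a function with finitely many
  values.\<close>

lemma quasilocal_bounded:
  fixes f :: "(int \<Rightarrow> 'e::finite) \<Rightarrow> real"
  assumes "quasilocal f"
  obtains B where "\<And>x. \<bar>f x\<bar> \<le> B"
proof -
  obtain S where S: "finite S" "\<And>x y. (\<And>i. i \<in> S \<Longrightarrow> x i = y i) \<Longrightarrow> \<bar>f x - f y\<bar> \<le> 1"
    using quasilocalD[OF assms, of 1] by auto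
  have "finite (range (\<lambda>x. f (restrict x S)))"
    by (rule depends_on_finite_range[OF depends_on_truncate S(1)])
  then obtain C where C: "\<And>x. \<bar>f (restrict x S)\<bar> \<le> C"
    using finite_imp_bounded bounded_iff[of "range (\<lambda>x. f (restrict x S))"] by auto
  have "\<bar>f x\<bar> \<le> C + 1" for x
    using S(2)[of x "restrict x S"] C[of x] by auto
  then show ?thesis by (rule that)
qed

lemma quasilocal_measurable:
  fixes f :: "(int \<Rightarrow> 'e::finite) \<Rightarrow> real"
  assumes "quasilocal f"
  shows "f \<in> borel_measurable XM"
proof (rule borel_measurable_LIMSEQ_real)
  let ?I = "\<lambda>n::nat. {- int n..int n}"
  show "(\<lambda>x. f (restrict x (?I n))) \<in> borel_measurable XM" for n
    by (rule depends_on_measurable[OF depends_on_truncate]) auto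
  show "(\<lambda>n. f (restrict x (?I n))) \<longlonglongrightarrow> f x" for x
  proof (rule LIMSEQ_I)
    fix r :: real assume "r > 0"
    then obtain S where S: "finite S" "\<And>x y. (\<And>i. i \<in> S \<Longrightarrow> x i = y i) \<Longrightarrow> \<bar>f x - f y\<bar> \<le> r / 2"
      using quasilocalD[OF assms, of "r / 2"] by auto
    \<comment> \<open>From index \<open>m\<close> on the box contains \<open>S\<close>; the inserted
      0 keeps \<open>Max\<close> meaningful when \<open>S\<close> is empty.\<close>
    define m where "m = Max (insert 0 ((\<lambda>i. nat \<bar>i\<bar>) ` S))"
    have "\<bar>f (restrict x (?I n)) - f x\<bar> \<le> r / 2" if "n \<ge> m" for n
    proof (rule S(2))
      fix i assume "i \<in> S"
      then have "nat \<bar>i\<bar> \<le> m" unfolding m_def using S(1) by (intro Max_ge) auto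
      then show "restrict x (?I n) i = x i" using that by auto
    qed
    then show "\<exists>no. \<forall>n\<ge>no. norm (f (restrict x (?I n)) - f x) < r"
      using \<open>r > 0\<close> by (intro exI[of _ m]) fastforce
  qed
qed

section \<open>Unordered real sums, sup norm and oscillation\<close>

lemma summable_on_abs_le:
  fixes f g :: "'a \<Rightarrow> real"
  assumes "g summable_on A" and le: "\<And>x. x \<in> A \<Longrightarrow> \<bar>f x\<bar> \<le> g x"
  shows "f summable_on A" "\<bar>infsum f A\<bar> \<le> infsum g A"
proof -
  have "(\<lambda>x. norm (g x)) summable_on A"
    using assms(1) Infinite_Sum.summable_on_iff_abs_summable_on_real by blast
  then have n: "(\<lambda>x. norm (f x)) summable_on A"
    by (rule Infinite_Sum.abs_summable_on_comparison_test) (use le in fastforce)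
  then show "f summable_on A" by (rule Infinite_Sum.abs_summable_summable)
  have "norm (infsum f A) \<le> infsum (\<lambda>x. norm (f x)) A" by (rule norm_infsum_bound[OF n])
  also have "\<dots> \<le> infsum g A" by (rule infsum_mono[OF n assms(1)]) (use le in simp)
  finally show "\<bar>infsum f A\<bar> \<le> infsum g A" by simp
qed

lemma infsum_diff_real:
  fixes f g :: "'a \<Rightarrow> real"
  assumes "f summable_on A" "g summable_on A"
  shows "(\<Sum>\<^sub>\<infinity>x\<in>A. f x - g x) = infsum f A - infsum g A"
  using infsum_add[OF assms(1), of "\<lambda>x. - g x"] assms(2)
  by (simp add: infsum_uminus summable_on_uminus)

text \<open>A real \<open>SUP\<close> bounds its elements only if the set is bounded above; the
  finite range of a local function supplies this.\<close>

lemma depends_on_abs_le_supnorm: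
  fixes f :: "(int \<Rightarrow> 'e::finite) \<Rightarrow> real"
  assumes "depends_on S f" "finite S"
  shows "\<bar>f x\<bar> \<le> supnorm f"
proof -
  have "finite ((\<lambda>r. \<bar>r\<bar>) ` range f)"
    using depends_on_finite_range[OF assms] by (rule finite_imageI)
  then have "finite (range (\<lambda>x. \<bar>f x\<bar>))" by (simp add: image_image)
  then show ?thesis
    unfolding supnorm_def by (intro cSUP_upper[OF UNIV_I] bdd_above_finite)
qed

lemma depends_on_diff_le_osc:
  fixes f :: "(int \<Rightarrow> 'e::finite) \<Rightarrow> real"
  assumes "depends_on S f" "finite S"
  shows "\<bar>f x - f y\<bar> \<le> osc f"
proof -
  have "finite ((\<lambda>(a, b). \<bar>a - b\<bar>) ` (range f \<times> range f))"
    by (rule finite_imageI[OF finite_cartesian_product]) (rule depends_on_finite_range[OF assms])+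
  then have "finite (range (\<lambda>p. \<bar>f (fst p) - f (snd p)\<bar>))"
    by (rule finite_subset[rotated]) auto
  then have "bdd_above (range (\<lambda>p. \<bar>f (fst p) - f (snd p)\<bar>))"
    by (rule bdd_above_finite)
  then have "\<bar>f (fst (x, y)) - f (snd (x, y))\<bar> \<le> osc f"
    unfolding osc_def by (rule cSUP_upper[OF UNIV_I])
  then show ?thesis by simp
qed

lemma osc_zero [simp]: "osc (\<lambda>_. 0) = 0"
  by (simp add: osc_def)

lemma supnorm_zero [simp]: "supnorm (\<lambda>_. 0) = 0"
  by (simp add: supnorm_def)

subsection \<open>Hamiltonians and Gibbs kernels\<close>

locale uac_interaction =
  fixes Phi :: "int set \<Rightarrow> (int \<Rightarrow> 'e::finite) \<Rightarrow> real"
  assumes interaction: "is_interaction Phi" and uac: "uac Phi"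
begin

lemma Phi_depends_on: "finite V \<Longrightarrow> depends_on V (Phi V)"
  using interaction by (auto simp: is_interaction_def depends_on_def)

lemma Phi_le_supnorm: "finite V \<Longrightarrow> \<bar>Phi V x\<bar> \<le> supnorm (Phi V)"
  using depends_on_abs_le_supnorm[OF Phi_depends_on] .

lemma Phi_diff_le_osc: "finite V \<Longrightarrow> \<bar>Phi V x - Phi V y\<bar> \<le> osc (Phi V)"
  using depends_on_diff_le_osc[OF Phi_depends_on] .

lemma osc_nonneg: "finite V \<Longrightarrow> 0 \<le> osc (Phi V)"
  using Phi_diff_le_osc[of V undefined undefined] by simp

lemma osc_le_supnorm: "finite V \<Longrightarrow> osc (Phi V) \<le> 2 * supnorm (Phi V)"
  unfolding osc_def
proof (rule cSUP_least)
  fix p :: "(int \<Rightarrow> 'e) \<times> (int \<Rightarrow> 'e)" assume "finite V"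
  from Phi_le_supnorm[OF this, of "fst p"] Phi_le_supnorm[OF this, of "snd p"]
  show "\<bar>Phi V (fst p) - Phi V (snd p)\<bar> \<le> 2 * supnorm (Phi V)" by linarith
qed simp

text \<open>\<open>uac\<close> controls the sets through one site, and the sets meeting
  \<open>L\<close> are a finite union of such families; overlaps are removed to add the
  sums.\<close>

lemma supnorm_summable:
  assumes "finite L"
  shows "(\<lambda>V. supnorm (Phi V)) summable_on {V. finite V \<and> V \<inter> L \<noteq> {}}"
  using assms
proof (induction L)
  case (insert i L)
  let ?A = "{V. finite V \<and> i \<in> V}" and ?B = "{V. finite V \<and> V \<inter> L \<noteq> {}}"
  have "(\<lambda>V. supnorm (Phi V)) summable_on ?A"
    using uac by (auto simp: uac_def)
  moreover have "(\<lambda>V. supnorm (Phi V)) summable_on (?B - ?A)"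
    by (rule summable_on_subset_banach[OF insert.IH]) auto
  ultimately have "(\<lambda>V. supnorm (Phi V)) summable_on (?A \<union> (?B - ?A))"
    by (rule summable_on_Un_disjoint) auto
  moreover have "?A \<union> (?B - ?A) = {V. finite V \<and> V \<inter> insert i L \<noteq> {}}" by auto
  ultimately show ?case by simp
qed simp

lemma Phi_summable:
  assumes "finite L"
  shows "(\<lambda>V. Phi V x) summable_on {V. finite V \<and> V \<inter> L \<noteq> {}}"
  by (rule summable_on_abs_le(1)[OF supnorm_summable[OF assms]]) (use Phi_le_supnorm in auto)

lemma osc_summable:
  assumes "finite L" "B \<subseteq> {V. finite V \<and> V \<inter> L \<noteq> {}}"
  shows "(\<lambda>V. osc (Phi V)) summable_on B"
proof (rule summable_on_subset_banach[OF _ assms(2)])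
  show "(\<lambda>V. osc (Phi V)) summable_on {V. finite V \<and> V \<inter> L \<noteq> {}}"
    by (rule summable_on_abs_le(1)[OF summable_on_cmult_right[OF supnorm_summable[OF assms(1)], of 2]])
      (use osc_le_supnorm osc_nonneg in auto)
qed

text \<open>\<open>B\<close> collects the terms that are allowed to change. Taken as the sets
  through two given sites it yields the Dobrushin coefficient; taken as the complement of a finite
  family it yields quasilocality.\<close>

lemma hamiltonian_diff:
  assumes L: "finite L" and B: "B \<subseteq> {V. finite V \<and> V \<inter> L \<noteq> {}}"
    and eq: "\<And>V i. finite V \<Longrightarrow> V \<inter> L \<noteq> {} \<Longrightarrow> V \<notin> B \<Longrightarrow> i \<in> V \<Longrightarrow> x i = y i"
  shows "\<bar>hamiltonian Phi L x - hamiltonian Phi L y\<bar> \<le> (\<Sum>\<^sub>\<infinity>V\<in>B. osc (Phi V))"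
proof -
  let ?I = "{V. finite V \<and> V \<inter> L \<noteq> {}}"
  have "hamiltonian Phi L x - hamiltonian Phi L y = (\<Sum>\<^sub>\<infinity>V\<in>?I. Phi V x - Phi V y)"
    unfolding hamiltonian_def using Phi_summable[OF L, of x] Phi_summable[OF L, of y]
    by (simp add: infsum_diff_real)
  also have "\<dots> = (\<Sum>\<^sub>\<infinity>V\<in>B. Phi V x - Phi V y)"
  proof (rule infsum_cong_neutral)
    fix V assume V: "V \<in> ?I - B"
    then have "Phi V x = Phi V y" by (intro depends_onD[OF Phi_depends_on]) (use eq in auto)
    then show "Phi V x - Phi V y = 0" by simp
  qed (use B in auto)
  finally have *: "hamiltonian Phi L x - hamiltonian Phi L y = (\<Sum>\<^sub>\<infinity>V\<in>B. Phi V x - Phi V y)" .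
  have le: "\<bar>Phi V x - Phi V y\<bar> \<le> osc (Phi V)" if "V \<in> B" for V
    using Phi_diff_le_osc[of V] that B by auto
  show ?thesis
    unfolding * by (rule summable_on_abs_le(2)[OF osc_summable[OF L B] le])
qed

text \<open>Some finite family \<open>F\<close> leaves a tail of oscillations of at most
  \<open>e\<close>, and agreement on the union of \<open>F\<close> freezes every term in
  \<open>F\<close>.\<close>

lemma hamiltonian_quasilocal:
  assumes "finite L" shows "quasilocal (hamiltonian Phi L)"
proof (rule quasilocalI)
  fix e :: real assume "e > 0"
  let ?I = "{V. finite V \<and> V \<inter> L \<noteq> {}}"
  have sm: "(\<lambda>V. osc (Phi V)) summable_on ?I" by (rule osc_summable[OF assms]) auto
  obtain F where F: "finite F" "F \<subseteq> ?I"
      and d: "dist (sum (\<lambda>V. osc (Phi V)) F) (\<Sum>\<^sub>\<infinity>V\<in>?I. osc (Phi V)) \<le> e"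
    using infsum_finite_approximation[OF sm \<open>e > 0\<close>] by auto
  have "(\<Sum>\<^sub>\<infinity>V\<in>F \<union> (?I - F). osc (Phi V)) = (\<Sum>\<^sub>\<infinity>V\<in>F. osc (Phi V)) + (\<Sum>\<^sub>\<infinity>V\<in>?I - F. osc (Phi V))"
    by (rule infsum_Un_disjoint) (use F in \<open>auto intro!: summable_on_subset_banach[OF sm]\<close>)
  moreover have "F \<union> (?I - F) = ?I" using F by blast
  ultimately have le: "(\<Sum>\<^sub>\<infinity>V\<in>?I - F. osc (Phi V)) \<le> e"
    using d F(1) by (simp add: dist_real_def)
  have "\<bar>hamiltonian Phi L x - hamiltonian Phi L y\<bar> \<le> e" if "\<forall>i\<in>\<Union>F. x i = y i" for x y
  proof -
    have "\<bar>hamiltonian Phi L x - hamiltonian Phi L y\<bar> \<le> (\<Sum>\<^sub>\<infinity>V\<in>?I - F. osc (Phi V))"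
      by (rule hamiltonian_diff[OF assms]) (use that in auto)
    with le show ?thesis by simp
  qed
  moreover have "finite (\<Union>F)" using F by auto
  ultimately show "\<exists>S. finite S \<and> (\<forall>x y. (\<forall>i\<in>S. x i = y i) \<longrightarrow>
      \<bar>hamiltonian Phi L x - hamiltonian Phi L y\<bar> \<le> e)" by (intro exI[of _ "\<Union>F"]) simp
qed

lemma hamiltonian_measurable: "finite L \<Longrightarrow> hamiltonian Phi L \<in> borel_measurable XM"
  by (intro quasilocal_measurable hamiltonian_quasilocal)

lemma partition_pos:
  "finite L \<Longrightarrow> (\<Sum>\<tau>\<in>local_conf L. exp (- hamiltonian Phi L (merge_conf L \<tau> \<eta>))) > 0"
  by (intro sum_pos finite_local_conf local_conf_nonempty) auto

lemma gibbs_spec_nonneg: "0 \<le> gibbs_spec Phi L \<sigma> \<eta>"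
  unfolding gibbs_spec_def by (intro divide_nonneg_nonneg sum_nonneg) auto

lemma gibbs_spec_sum: "finite L \<Longrightarrow> (\<Sum>\<sigma>\<in>local_conf L. gibbs_spec Phi L \<sigma> \<eta>) = 1"
  unfolding gibbs_spec_def sum_divide_distrib[symmetric] using partition_pos[of L \<eta>] by simp

lemma gibbs_spec_measurable:
  assumes "finite L" shows "gibbs_spec Phi L \<sigma> \<in> borel_measurable XM"
proof -
  have [measurable]: "hamiltonian Phi L \<in> borel_measurable XM"
    by (rule hamiltonian_measurable[OF assms])
  have "(\<lambda>\<eta>. gibbs_spec Phi L \<sigma> \<eta>) \<in> borel_measurable XM"
    unfolding gibbs_spec_def by measurable
  then show ?thesis by simp
qed

definition spec_mean :: "int set \<Rightarrow> ((int \<Rightarrow> 'e) \<Rightarrow> real) \<Rightarrow> (int \<Rightarrow> 'e) \<Rightarrow> real" where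
  "spec_mean L f \<eta> = (\<Sum>\<sigma>\<in>local_conf L. gibbs_spec Phi L \<sigma> \<eta> * f (merge_conf L \<sigma> \<eta>))"

lemma spec_mean_diff:
  assumes "finite L"
    and "\<And>\<sigma>. \<bar>hamiltonian Phi L (merge_conf L \<sigma> x) - hamiltonian Phi L (merge_conf L \<sigma> y)\<bar> \<le> e"
    and "\<And>\<sigma>. \<bar>f (merge_conf L \<sigma> x) - f (merge_conf L \<sigma> y)\<bar> \<le> d"
    and "\<And>\<sigma> \<tau>. \<bar>f (merge_conf L \<sigma> y) - f (merge_conf L \<tau> y)\<bar> \<le> D"
  shows "\<bar>spec_mean L f x - spec_mean L f y\<bar> \<le> d + D * e / 2"
  unfolding spec_mean_def gibbs_spec_def
  by (rule exp_average_diff) (use assms in \<open>simp_all add: finite_local_conf local_conf_nonempty\<close>)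

text \<open>This closure property is what allows the single-site averaging to be iterated: the
  exterior enters through the whole Hamiltonian, so locality may be lost, but approximation by
  finite windows survives.\<close>

lemma spec_mean_quasilocal:
  assumes L: "finite L" and f: "quasilocal f"
  shows "quasilocal (spec_mean L f)"
proof (rule quasilocalI)
  fix e :: real assume e: "e > 0"
  obtain C where C: "\<And>x. \<bar>f x\<bar> \<le> C" by (rule quasilocal_bounded[OF f]) (rule that)
  define B where "B = max C 1"
  have B: "B > 0" "\<And>x. \<bar>f x\<bar> \<le> B" using C by (auto simp: B_def intro: max.coboundedI1)
  \<comment> \<open>Calibrated so that the error \<open>2 * B * e1 / 2\<close> from the weights
    equals the error \<open>e / 2\<close> from \<open>f\<close>; \<open>B\<close> is at least 1, so
    the division is safe.\<close>
  define e1 where "e1 = e / (2 * B)"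
  have e1: "e1 > 0" using e B by (simp add: e1_def)
  obtain S where S: "finite S" "\<And>x y. (\<And>i. i \<in> S \<Longrightarrow> x i = y i) \<Longrightarrow> \<bar>f x - f y\<bar> \<le> e / 2"
    by (rule quasilocalD[OF f, of "e / 2"]) (use e in auto)
  obtain T where T: "finite T" "\<And>x y. (\<And>i. i \<in> T \<Longrightarrow> x i = y i) \<Longrightarrow>
      \<bar>hamiltonian Phi L x - hamiltonian Phi L y\<bar> \<le> e1"
    by (rule quasilocalD[OF hamiltonian_quasilocal[OF L] e1]) auto
  have "\<bar>spec_mean L f x - spec_mean L f y\<bar> \<le> e" if xy: "\<forall>i\<in>S \<union> T. x i = y i" for x y
  proof -
    have "\<bar>spec_mean L f x - spec_mean L f y\<bar> \<le> e / 2 + (2 * B) * e1 / 2"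
    proof (rule spec_mean_diff[OF L])
      fix \<sigma> \<tau>
      show "\<bar>f (merge_conf L \<sigma> y) - f (merge_conf L \<tau> y)\<bar> \<le> 2 * B"
        using B(2)[of "merge_conf L \<sigma> y"] B(2)[of "merge_conf L \<tau> y"] by linarith
      show "\<bar>f (merge_conf L \<sigma> x) - f (merge_conf L \<sigma> y)\<bar> \<le> e / 2"
        by (rule S(2)) (use xy in \<open>auto simp: merge_conf_def\<close>)
      show "\<bar>hamiltonian Phi L (merge_conf L \<sigma> x) - hamiltonian Phi L (merge_conf L \<sigma> y)\<bar> \<le> e1"
        by (rule T(2)) (use xy in \<open>auto simp: merge_conf_def\<close>)
    qed
    also have "\<dots> = e" using B by (simp add: e1_def)
    finally show ?thesis .
  qed
  then show "\<exists>S. finite S \<and> (\<forall>x y. (\<forall>i\<in>S. x i = y i) \<longrightarrow> \<bar>spec_mean L f x - spec_mean L f y\<bar> \<le> e)"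
    using S(1) T(1) by (intro exI[of _ "S \<union> T"]) simp
qed

end

section \<open>Extended nonnegative sums as counting measure integrals\<close>

text \<open>A bridge from the unordered sum in \<open>dobrushin\<close> to integrals, where Tonelli
  is available. Finite partial sums lie below the integral; conversely an enumeration of
  \<open>A\<close> exhausts it by finite sets \<open>F n\<close>, and monotone convergence
  applies.\<close>

lemma infsum_ennreal_eq_nn_integral:
  fixes f :: "'a \<Rightarrow> ennreal"
  assumes A: "countable A"
  shows "(\<Sum>\<^sub>\<infinity>x\<in>A. f x) = (\<integral>\<^sup>+x. f x \<partial>count_space A)"
proof (rule antisym)
  have eq: "(\<Sum>\<^sub>\<infinity>x\<in>A. f x) = (SUP F\<in>{F. finite F \<and> F \<subseteq> A}. sum f F)"
    by (rule nonneg_infsum_complete) simp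
  have fin: "(\<integral>\<^sup>+x. f x * indicator F x \<partial>count_space A) = sum f F" if "finite F" "F \<subseteq> A" for F
  proof -
    have "(\<integral>\<^sup>+x. f x * indicator F x \<partial>count_space A) = (\<Sum>x\<in>F. f x * indicator F x)"
      by (rule nn_integral_count_space') (use that in auto)
    then show ?thesis by simp
  qed
  show "(\<Sum>\<^sub>\<infinity>x\<in>A. f x) \<le> (\<integral>\<^sup>+x. f x \<partial>count_space A)"
    unfolding eq
  proof (rule SUP_least)
    fix F assume F: "F \<in> {F. finite F \<and> F \<subseteq> A}"
    then have "sum f F = (\<integral>\<^sup>+x. f x * indicator F x \<partial>count_space A)" using fin by simp
    also have "\<dots> \<le> (\<integral>\<^sup>+x. f x \<partial>count_space A)"
      by (intro nn_integral_mono) (auto split: split_indicator)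
    finally show "sum f F \<le> (\<integral>\<^sup>+x. f x \<partial>count_space A)" .
  qed
  define F where "F n = {a\<in>A. to_nat_on A a < n}" for n
  have F: "finite (F n)" "F n \<subseteq> A" for n
  proof -
    have "inj_on (to_nat_on A) (F n)"
      by (rule inj_on_subset[OF inj_on_to_nat_on[OF A]]) (auto simp: F_def)
    moreover have "finite (to_nat_on A ` F n)"
      by (rule finite_subset[of _ "{..<n}"]) (auto simp: F_def)
    ultimately show "finite (F n)" by (simp add: finite_image_iff)
  qed (auto simp: F_def)
  have "(\<integral>\<^sup>+x. f x \<partial>count_space A) = (\<integral>\<^sup>+x. (SUP n. f x * indicator (F n) x) \<partial>count_space A)"
  proof (rule nn_integral_cong)
    fix x assume "x \<in> space (count_space A)"
    then have "x \<in> F (Suc (to_nat_on A x))" by (auto simp: F_def)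
    then have "f x \<le> f x * indicator (F (Suc (to_nat_on A x))) x" by simp
    also have "\<dots> \<le> (SUP n. f x * indicator (F n) x)" by (rule SUP_upper) simp
    finally show "f x = (SUP n. f x * indicator (F n) x)"
      by (rule antisym) (auto intro!: SUP_least split: split_indicator)
  qed
  also have "\<dots> = (SUP n. \<integral>\<^sup>+x. f x * indicator (F n) x \<partial>count_space A)"
    by (rule nn_integral_monotone_convergence_SUP)
      (auto simp: incseq_def le_fun_def F_def split: split_indicator)
  also have "\<dots> \<le> (\<Sum>\<^sub>\<infinity>x\<in>A. f x)"
    unfolding eq using F fin by (intro SUP_least) (auto intro!: SUP_upper)
  finally show "(\<integral>\<^sup>+x. f x \<partial>count_space A) \<le> (\<Sum>\<^sub>\<infinity>x\<in>A. f x)" .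
qed

text \<open>Both sides are the supremum of the same finite partial sums.\<close>

lemma ennreal_infsum:
  fixes f :: "'a \<Rightarrow> real"
  assumes "f summable_on A" "\<And>x. x \<in> A \<Longrightarrow> 0 \<le> f x"
  shows "ennreal (infsum f A) = (\<Sum>\<^sub>\<infinity>x\<in>A. ennreal (f x))"
proof -
  have "(SUP F\<in>{F. finite F \<and> F \<subseteq> A}. ennreal (sum f F)) =
      (SUP F\<in>{F. finite F \<and> F \<subseteq> A}. \<Sum>x\<in>F. ennreal (f x))"
    by (intro SUP_cong refl sum_ennreal[symmetric]) (use assms(2) in auto)
  then show ?thesis
    using infsum_nonneg_is_SUPREMUM_ennreal[OF assms]
      nonneg_infsum_complete[of A "\<lambda>x. ennreal (f x)"] by simp
qed

subsection \<open>Oscillation at a site\<close>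

text \<open>Valued in \<open>ennreal\<close> so that the supremum is genuine without any boundedness
  of \<open>f\<close>.\<close>

definition site_osc :: "((int \<Rightarrow> 'e) \<Rightarrow> real) \<Rightarrow> int \<Rightarrow> ennreal" where
  "site_osc f j = (SUP (x, y)\<in>{(x, y). \<forall>i. i \<noteq> j \<longrightarrow> x i = y i}. ennreal \<bar>f x - f y\<bar>)"

lemma site_osc_upper:
  assumes "\<And>i. i \<noteq> j \<Longrightarrow> x i = y i" shows "ennreal \<bar>f x - f y\<bar> \<le> site_osc f j"
proof -
  have "(case (x, y) of (x, y) \<Rightarrow> ennreal \<bar>f x - f y\<bar>) \<le> site_osc f j"
    unfolding site_osc_def by (rule SUP_upper) (use assms in auto)
  then show ?thesis by simp
qed

lemma site_osc_least:
  assumes "\<And>x y. (\<And>i. i \<noteq> j \<Longrightarrow> x i = y i) \<Longrightarrow> ennreal \<bar>f x - f y\<bar> \<le> K"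
  shows "site_osc f j \<le> K"
  unfolding site_osc_def by (rule SUP_least) (use assms in auto)

text \<open>Telescoping: \<open>x\<close> is turned into \<open>y\<close> one coordinate at a
  time.\<close>

lemma diff_le_sum_site_osc:
  assumes "finite S" "\<And>i. i \<notin> S \<Longrightarrow> x i = y i"
  shows "ennreal \<bar>f x - f y\<bar> \<le> (\<Sum>j\<in>S. site_osc f j)"
  using assms
proof (induction S arbitrary: x)
  case empty
  then have "x = y" by auto
  then show ?case by simp
next
  case (insert j S)
  let ?z = "x(j := y j)"
  have "ennreal \<bar>f x - f y\<bar> \<le> ennreal (\<bar>f x - f ?z\<bar> + \<bar>f ?z - f y\<bar>)"
    by (intro ennreal_leI) simp
  also have "\<dots> = ennreal \<bar>f x - f ?z\<bar> + ennreal \<bar>f ?z - f y\<bar>" by simp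
  also have "\<dots> \<le> site_osc f j + (\<Sum>j\<in>S. site_osc f j)"
  proof (intro add_mono)
    show "ennreal \<bar>f x - f ?z\<bar> \<le> site_osc f j" by (rule site_osc_upper) simp
    show "ennreal \<bar>f ?z - f y\<bar> \<le> (\<Sum>j\<in>S. site_osc f j)"
      by (rule insert.IH) (use insert.prems in auto)
  qed
  finally show ?case using insert.hyps by simp
qed

lemma site_osc_depends_on:
  assumes "depends_on S f" "j \<notin> S" shows "site_osc f j = 0"
proof -
  have "site_osc f j \<le> 0"
  proof (rule site_osc_least)
    fix x y :: "int \<Rightarrow> 'a" assume "\<And>i. i \<noteq> j \<Longrightarrow> x i = y i"
    then have "f x = f y" using assms(2) by (intro depends_onD[OF assms(1)]) metis
    then show "ennreal \<bar>f x - f y\<bar> \<le> 0" by simp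
  qed
  then show ?thesis by simp
qed

lemma site_osc_truncate: "site_osc (\<lambda>x. f (restrict x S)) j \<le> site_osc f j"
  by (rule site_osc_least, rule site_osc_upper) (auto simp: restrict_def)

lemma site_osc_finite:
  fixes f :: "(int \<Rightarrow> 'e::finite) \<Rightarrow> real"
  assumes "quasilocal f" shows "site_osc f j < top"
proof -
  obtain B where B: "\<And>x. \<bar>f x\<bar> \<le> B" by (rule quasilocal_bounded[OF assms]) (rule that)
  have "site_osc f j \<le> ennreal (2 * B)"
  proof (rule site_osc_least, rule ennreal_leI)
    show "\<bar>f x - f y\<bar> \<le> 2 * B" for x y using B[of x] B[of y] by linarith
  qed
  also have "\<dots> < top" by simp
  finally show ?thesis .
qed

section \<open>Integrals of quasilocal functions and the Gibbs property\<close>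

text \<open>The pointwise bound is integrated in one variable under \<mu> and in the other under
  \<nu>, in effect under the product coupling. An infinite \<open>K\<close> is trivial.\<close>

lemma integral_diff_le_ennreal:
  fixes f :: "'a \<Rightarrow> real"
  assumes \<mu>: "prob_space \<mu>" and \<nu>: "prob_space \<nu>"
    and f: "integrable \<mu> f" "integrable \<nu> f"
    and K: "\<And>x y. ennreal \<bar>f x - f y\<bar> \<le> K"
  shows "ennreal \<bar>(\<integral>x. f x \<partial>\<mu>) - (\<integral>x. f x \<partial>\<nu>)\<bar> \<le> K"
proof (cases K)
  case (real M)
  interpret \<mu>: prob_space \<mu> by fact
  interpret \<nu>: prob_space \<nu> by fact
  have M: "\<bar>f x - f y\<bar> \<le> M" for x y using K[of x y] real by simp
  have "(\<integral>x. f x \<partial>\<mu>) \<le> f y + M" for y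
  proof -
    have "f x \<le> f y + M" for x using M[of x y] by linarith
    then have "(\<integral>x. f x \<partial>\<mu>) \<le> (\<integral>x. f y + M \<partial>\<mu>)" by (intro integral_mono f) auto
    then show ?thesis by (simp add: \<mu>.prob_space)
  qed
  then have "(\<integral>y. (\<integral>x. f x \<partial>\<mu>) - M \<partial>\<nu>) \<le> (\<integral>y. f y \<partial>\<nu>)"
    by (intro integral_mono f) (auto simp: algebra_simps)
  moreover have "f y - M \<le> (\<integral>x. f x \<partial>\<mu>)" for y
  proof -
    have "f y - M \<le> f x" for x using M[of x y] by linarith
    then have "(\<integral>x. f y - M \<partial>\<mu>) \<le> (\<integral>x. f x \<partial>\<mu>)" by (intro integral_mono f) auto
    then show ?thesis by (simp add: \<mu>.prob_space)
  qed
  then have "(\<integral>y. f y \<partial>\<nu>) \<le> (\<integral>y. (\<integral>x. f x \<partial>\<mu>) + M \<partial>\<nu>)"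
    by (intro integral_mono f) (auto simp: algebra_simps)
  ultimately have "\<bar>(\<integral>x. f x \<partial>\<mu>) - (\<integral>x. f x \<partial>\<nu>)\<bar> \<le> M"
    by (simp add: \<nu>.prob_space)
  then show ?thesis using real by (simp add: ennreal_leI)
qed simp

lemma quasilocal_integrable:
  fixes f :: "(int \<Rightarrow> 'e::finite) \<Rightarrow> real"
  assumes "quasilocal f" "prob_space \<mu>" "sets \<mu> = sets XM"
  shows "integrable \<mu> f"
proof -
  interpret prob_space \<mu> by fact
  obtain B where B: "\<And>x. \<bar>f x\<bar> \<le> B" by (rule quasilocal_bounded[OF assms(1)]) (rule that)
  have "f \<in> borel_measurable \<mu>"
    using quasilocal_measurable[OF assms(1)] assms(3) by (simp cong: measurable_cong_sets)
  then show ?thesis using B by (intro integrable_const_bound[of _ B]) auto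
qed

lemma is_gibbs_prob_space: "is_gibbs Phi \<mu> \<Longrightarrow> prob_space \<mu>"
  and is_gibbs_sets: "is_gibbs Phi \<mu> \<Longrightarrow> sets \<mu> = sets XM"
  by (auto simp: is_gibbs_def)

context uac_interaction
begin

text \<open>\<open>is_gibbs\<close> speaks of events only. Induction over nonnegative measurable
  functions extends it, and values in \<open>ennreal\<close> spare all integrability
  conditions.\<close>

lemma gibbs_nn_integral:
  fixes f :: "(int \<Rightarrow> 'e) \<Rightarrow> ennreal"
  assumes gibbs: "is_gibbs Phi \<mu>" and L: "finite L" and f: "f \<in> borel_measurable XM"
  shows "(\<integral>\<^sup>+x. f x \<partial>\<mu>) =
    (\<integral>\<^sup>+\<eta>. (\<Sum>\<sigma>\<in>local_conf L. ennreal (gibbs_spec Phi L \<sigma> \<eta>) * f (merge_conf L \<sigma> \<eta>)) \<partial>\<mu>)"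
proof -
  have sets [measurable_cong]: "sets \<mu> = sets XM" by (rule is_gibbs_sets[OF gibbs])
  have space [simp]: "space \<mu> = UNIV" using sets_eq_imp_space_eq[OF sets] by simp
  interpret prob_space \<mu> by (rule is_gibbs_prob_space[OF gibbs])
  note [measurable] = gibbs_spec_measurable[OF L]
  show ?thesis
    using f
  proof (induction f rule: borel_measurable_induct)
    case (cong f g)
    then have "f = g" by auto
    with cong show ?case by simp
  next
    case (set A)
    note [measurable] = set
    have le: "(\<Sum>\<sigma>\<in>local_conf L. gibbs_spec Phi L \<sigma> \<eta> * indicator A (merge_conf L \<sigma> \<eta>)) \<le> 1" for \<eta>
    proof -
      have "(\<Sum>\<sigma>\<in>local_conf L. gibbs_spec Phi L \<sigma> \<eta> * indicator A (merge_conf L \<sigma> \<eta>)) \<le>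
          (\<Sum>\<sigma>\<in>local_conf L. gibbs_spec Phi L \<sigma> \<eta>)"
        using gibbs_spec_nonneg by (intro sum_mono) (auto split: split_indicator)
      then show ?thesis by (simp add: gibbs_spec_sum[OF L])
    qed
    have nn: "0 \<le> (\<Sum>\<sigma>\<in>local_conf L. gibbs_spec Phi L \<sigma> \<eta> * indicator A (merge_conf L \<sigma> \<eta>))" for \<eta>
      using gibbs_spec_nonneg by (intro sum_nonneg) auto
    have "(\<integral>\<^sup>+x. indicator A x \<partial>\<mu>) = emeasure \<mu> A" using set sets by simp
    also have "\<dots> = ennreal (\<integral>\<eta>. (\<Sum>\<sigma>\<in>local_conf L. gibbs_spec Phi L \<sigma> \<eta> * indicator A (merge_conf L \<sigma> \<eta>)) \<partial>\<mu>)"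
      using gibbs L set by (simp add: emeasure_eq_measure is_gibbs_def)
    also have "\<dots> = (\<integral>\<^sup>+\<eta>. ennreal (\<Sum>\<sigma>\<in>local_conf L. gibbs_spec Phi L \<sigma> \<eta> * indicator A (merge_conf L \<sigma> \<eta>)) \<partial>\<mu>)"
      using nn le by (intro nn_integral_eq_integral[symmetric] integrable_const_bound[of _ 1]) auto
    also have "\<dots> = (\<integral>\<^sup>+\<eta>. (\<Sum>\<sigma>\<in>local_conf L. ennreal (gibbs_spec Phi L \<sigma> \<eta>) * indicator A (merge_conf L \<sigma> \<eta>)) \<partial>\<mu>)"
    proof (rule nn_integral_cong)
      fix \<eta>
      have "ennreal (\<Sum>\<sigma>\<in>local_conf L. gibbs_spec Phi L \<sigma> \<eta> * indicator A (merge_conf L \<sigma> \<eta>)) =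
          (\<Sum>\<sigma>\<in>local_conf L. ennreal (gibbs_spec Phi L \<sigma> \<eta> * indicator A (merge_conf L \<sigma> \<eta>)))"
        using gibbs_spec_nonneg by (intro sum_ennreal[symmetric]) auto
      then show "ennreal (\<Sum>\<sigma>\<in>local_conf L. gibbs_spec Phi L \<sigma> \<eta> * indicator A (merge_conf L \<sigma> \<eta>)) =
          (\<Sum>\<sigma>\<in>local_conf L. ennreal (gibbs_spec Phi L \<sigma> \<eta>) * indicator A (merge_conf L \<sigma> \<eta>))"
        by (simp add: ennreal_mult'' ennreal_indicator)
    qed
    finally show ?case .
  next
    case (mult u c)
    note [measurable] = mult.hyps(2)
    show ?case
      using mult.IH by (simp add: nn_integral_cmult mult.left_commute[of _ c] flip: sum_distrib_left)
  next
    case (add u v)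
    note [measurable] = add.hyps(1) add.hyps(3)
    show ?case
      using add.IH by (simp add: nn_integral_add distrib_left sum.distrib)
  next
    case (seq U)
    note [measurable] = seq.hyps(1)
    have inc: "incseq (\<lambda>i. U i x)" for x using seq.hyps by (auto simp: incseq_def le_fun_def)
    have "(\<integral>\<^sup>+x. (SUP i. U i) x \<partial>\<mu>) = (SUP i. \<integral>\<^sup>+x. U i x \<partial>\<mu>)"
      unfolding SUP_apply by (rule nn_integral_monotone_convergence_SUP) (use seq.hyps in auto)
    also have "\<dots> = (SUP i. \<integral>\<^sup>+\<eta>. (\<Sum>\<sigma>\<in>local_conf L. ennreal (gibbs_spec Phi L \<sigma> \<eta>) * U i (merge_conf L \<sigma> \<eta>)) \<partial>\<mu>)"
      using seq.IH by simp
    also have "\<dots> = (\<integral>\<^sup>+\<eta>. (SUP i. \<Sum>\<sigma>\<in>local_conf L. ennreal (gibbs_spec Phi L \<sigma> \<eta>) * U i (merge_conf L \<sigma> \<eta>)) \<partial>\<mu>)"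
      by (rule nn_integral_monotone_convergence_SUP[symmetric])
        (use inc in \<open>auto simp: incseq_def le_fun_def intro!: sum_mono mult_left_mono\<close>)
    also have "\<dots> = (\<integral>\<^sup>+\<eta>. (\<Sum>\<sigma>\<in>local_conf L. ennreal (gibbs_spec Phi L \<sigma> \<eta>) * (SUP i. U i) (merge_conf L \<sigma> \<eta>)) \<partial>\<mu>)"
      unfolding SUP_apply SUP_mult_left_ennreal
      by (intro nn_integral_cong ennreal_SUP_sum)
        (use inc in \<open>auto simp: incseq_def intro!: mult_left_mono\<close>)
    finally show ?case .
  qed
qed

lemma gibbs_integral_spec_mean:
  assumes gibbs: "is_gibbs Phi \<mu>" and L: "finite L" and f: "quasilocal f"
  shows "(\<integral>x. f x \<partial>\<mu>) = (\<integral>x. spec_mean L f x \<partial>\<mu>)"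
proof -
  have sets [measurable_cong]: "sets \<mu> = sets XM" by (rule is_gibbs_sets[OF gibbs])
  interpret prob_space \<mu> by (rule is_gibbs_prob_space[OF gibbs])
  obtain B where B: "\<And>x. \<bar>f x\<bar> \<le> B" by (rule quasilocal_bounded[OF f]) (rule that)
  note int = quasilocal_integrable[OF f prob_space_axioms sets]
    quasilocal_integrable[OF spec_mean_quasilocal[OF L f] prob_space_axioms sets]
  note [measurable] = gibbs_spec_measurable[OF L] quasilocal_measurable[OF f]
  \<comment> \<open>Shifting by the bound \<open>B\<close> makes \<open>f\<close> nonnegative; since
    the weights sum to 1, the shift passes unchanged through \<open>spec_mean\<close>.\<close>
  have pos: "0 \<le> f x + B" for x using B[of x] by linarith
  have mean: "spec_mean L f \<eta> + B = (\<Sum>\<sigma>\<in>local_conf L. gibbs_spec Phi L \<sigma> \<eta> * (f (merge_conf L \<sigma> \<eta>) + B))" for \<eta>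
    unfolding spec_mean_def
    by (simp add: distrib_left sum.distrib sum_distrib_right[symmetric] gibbs_spec_sum[OF L])
  have mean_pos: "0 \<le> spec_mean L f \<eta> + B" for \<eta>
    unfolding mean using gibbs_spec_nonneg pos by (intro sum_nonneg mult_nonneg_nonneg)
  have "ennreal (\<integral>x. f x + B \<partial>\<mu>) = (\<integral>\<^sup>+x. ennreal (f x + B) \<partial>\<mu>)"
    using int pos by (intro nn_integral_eq_integral[symmetric]) auto
  also have "\<dots> = (\<integral>\<^sup>+\<eta>. (\<Sum>\<sigma>\<in>local_conf L. ennreal (gibbs_spec Phi L \<sigma> \<eta>) * ennreal (f (merge_conf L \<sigma> \<eta>) + B)) \<partial>\<mu>)"
    by (rule gibbs_nn_integral[OF gibbs L]) simp
  also have "\<dots> = (\<integral>\<^sup>+\<eta>. ennreal (spec_mean L f \<eta> + B) \<partial>\<mu>)"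
    unfolding mean using gibbs_spec_nonneg pos
    by (intro nn_integral_cong) (simp add: ennreal_mult'[symmetric] sum_ennreal)
  also have "\<dots> = ennreal (\<integral>x. spec_mean L f x + B \<partial>\<mu>)"
    using int mean_pos by (intro nn_integral_eq_integral) auto
  finally have "(\<integral>x. f x + B \<partial>\<mu>) = (\<integral>x. spec_mean L f x + B \<partial>\<mu>)"
    using pos mean_pos by (subst (asm) ennreal_inj) (auto intro!: integral_nonneg_AE)
  then show ?thesis using int by simp
qed

end

subsection \<open>Dobrushin uniqueness\<close>

context uac_interaction
begin

text \<open>Stands in for the total variation influence of the spin at \<open>j\<close> on the
  conditional law at \<open>i\<close>, which it dominates for \<open>j\<close> different from
  \<open>i\<close>.\<close>

definition dobrushin_coeff :: "int \<Rightarrow> int \<Rightarrow> ennreal" where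
  "dobrushin_coeff i j = ennreal ((\<Sum>\<^sub>\<infinity>V\<in>{V. finite V \<and> i \<in> V \<and> j \<in> V}. osc (Phi V)) / 2)"

lemma spec_mean_singleton_const:
  assumes "\<And>k. k \<noteq> i \<Longrightarrow> x k = y k"
  shows "spec_mean {i} f x = spec_mean {i} f y"
proof -
  have "merge_conf {i} \<sigma> x = merge_conf {i} \<sigma> y" for \<sigma>
    using assms by (auto simp: merge_conf_def)
  then show ?thesis unfolding spec_mean_def gibbs_spec_def by simp
qed

lemma site_osc_spec_mean_self: "site_osc (spec_mean {i} f) i = 0"
proof -
  have "site_osc (spec_mean {i} f) i \<le> 0"
  proof (rule site_osc_least)
    fix x y :: "int \<Rightarrow> 'e" assume "\<And>k. k \<noteq> i \<Longrightarrow> x k = y k"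
    then show "ennreal \<bar>spec_mean {i} f x - spec_mean {i} f y\<bar> \<le> 0"
      using spec_mean_singleton_const[of i x y f] by simp
  qed
  then show ?thesis by simp
qed

text \<open>A change at \<open>j\<close> acts in two ways: on \<open>f\<close> itself, at cost
  \<open>site_osc f j\<close>, and on the weights at \<open>i\<close>. The energy at
  \<open>i\<close> changes only through sets containing both sites, and the weights act on the
  oscillation of \<open>f\<close> at \<open>i\<close>.\<close>

lemma site_osc_spec_mean:
  assumes "j \<noteq> i" and f: "quasilocal f"
  shows "site_osc (spec_mean {i} f) j \<le> site_osc f j + dobrushin_coeff i j * site_osc f i"
proof (rule site_osc_least)
  fix x y :: "int \<Rightarrow> 'e" assume xy: "\<And>k. k \<noteq> j \<Longrightarrow> x k = y k"
  let ?B = "{V. finite V \<and> i \<in> V \<and> j \<in> V}"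
  define e where "e = (\<Sum>\<^sub>\<infinity>V\<in>?B. osc (Phi V))"
  define d where "d = enn2real (site_osc f j)"
  define D where "D = enn2real (site_osc f i)"
  have d: "site_osc f j = ennreal d" and D: "site_osc f i = ennreal D"
    using site_osc_finite[OF f] by (simp_all add: d_def D_def)
  have nn: "0 \<le> d" "0 \<le> D" "0 \<le> e"
    unfolding e_def by (auto simp: d_def D_def intro!: infsum_nonneg osc_nonneg)
  have "\<bar>spec_mean {i} f x - spec_mean {i} f y\<bar> \<le> d + D * e / 2"
  proof (rule spec_mean_diff)
    fix \<sigma> \<tau> :: "int \<Rightarrow> 'e"
    show "\<bar>hamiltonian Phi {i} (merge_conf {i} \<sigma> x) - hamiltonian Phi {i} (merge_conf {i} \<sigma> y)\<bar> \<le> e"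
      unfolding e_def by (rule hamiltonian_diff) (auto simp: merge_conf_def intro: xy)
    have "ennreal \<bar>f (merge_conf {i} \<sigma> x) - f (merge_conf {i} \<sigma> y)\<bar> \<le> site_osc f j"
      by (rule site_osc_upper) (auto simp: merge_conf_def intro: xy)
    then show "\<bar>f (merge_conf {i} \<sigma> x) - f (merge_conf {i} \<sigma> y)\<bar> \<le> d"
      unfolding d by (simp add: nn)
    have "ennreal \<bar>f (merge_conf {i} \<sigma> y) - f (merge_conf {i} \<tau> y)\<bar> \<le> site_osc f i"
      by (rule site_osc_upper) (auto simp: merge_conf_def)
    then show "\<bar>f (merge_conf {i} \<sigma> y) - f (merge_conf {i} \<tau> y)\<bar> \<le> D"
      unfolding D by (simp add: nn)
  qed simp
  then have "ennreal \<bar>spec_mean {i} f x - spec_mean {i} f y\<bar> \<le> ennreal (d + e / 2 * D)"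
    by (intro ennreal_leI) (simp add: mult.commute)
  also have "\<dots> = ennreal d + ennreal (e / 2 * D)"
    using nn by (intro ennreal_plus) auto
  also have "ennreal (e / 2 * D) = ennreal (e / 2) * ennreal D"
    using nn by (intro ennreal_mult) auto
  finally show "ennreal \<bar>spec_mean {i} f x - spec_mean {i} f y\<bar> \<le>
      site_osc f j + dobrushin_coeff i j * site_osc f i"
    unfolding d D dobrushin_coeff_def e_def .
qed

lemma dobrushin_coeff_eq:
  "dobrushin_coeff i j = ennreal (1/2) *
     (\<integral>\<^sup>+V. ennreal (osc (Phi V)) * indicator {V. finite V \<and> i \<in> V \<and> j \<in> V} V \<partial>count_space UNIV)"
proof -
  let ?B = "{V. finite V \<and> i \<in> V \<and> j \<in> V}"
  have c: "countable ?B"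
    by (rule countable_subset[OF _ countable_Collect_finite]) auto
  have "ennreal (\<Sum>\<^sub>\<infinity>V\<in>?B. osc (Phi V)) = (\<Sum>\<^sub>\<infinity>V\<in>?B. ennreal (osc (Phi V)))"
    by (rule ennreal_infsum) (auto intro!: osc_nonneg osc_summable[of "{i}"])
  also have "\<dots> = (\<integral>\<^sup>+V. ennreal (osc (Phi V)) * indicator ?B V \<partial>count_space UNIV)"
    by (simp add: infsum_ennreal_eq_nn_integral[OF c] nn_integral_count_space_indicator)
  finally have *: "ennreal (\<Sum>\<^sub>\<infinity>V\<in>?B. osc (Phi V)) =
    (\<integral>\<^sup>+V. ennreal (osc (Phi V)) * indicator ?B V \<partial>count_space UNIV)" .
  have "dobrushin_coeff i j = ennreal (1/2) * ennreal (\<Sum>\<^sub>\<infinity>V\<in>?B. osc (Phi V))"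
    unfolding dobrushin_coeff_def
    by (subst ennreal_mult[symmetric]) (auto intro!: infsum_nonneg osc_nonneg)
  then show ?thesis unfolding * .
qed

text \<open>After swapping the sums, a set \<open>V\<close> through \<open>i\<close> is counted once
  for each of its other sites; this is the origin of the factor \<open>card V - 1\<close> in
  \<open>dobrushin\<close>.\<close>

lemma dobrushin_coeff_sum:
  "(\<integral>\<^sup>+j. indicator (- {i}) j * dobrushin_coeff i j \<partial>count_space UNIV) \<le> dobrushin Phi"
proof -
  let ?A = "{V. finite V \<and> i \<in> V}"
  let ?f = "\<lambda>(j, V). indicator (- {i}) j * (ennreal (osc (Phi V)) *
      indicator {V. finite V \<and> i \<in> V \<and> j \<in> V} V)"
  have "(\<integral>\<^sup>+j. indicator (- {i}) j * dobrushin_coeff i j \<partial>count_space UNIV) =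
      ennreal (1/2) * (\<integral>\<^sup>+j. \<integral>\<^sup>+V. ?f (j, V) \<partial>count_space UNIV \<partial>count_space UNIV)"
    unfolding dobrushin_coeff_eq mult.left_commute[of _ "ennreal (1/2)"]
    by (subst nn_integral_cmult) (simp_all add: nn_integral_cmult)
  also have "(\<integral>\<^sup>+j. \<integral>\<^sup>+V. ?f (j, V) \<partial>count_space UNIV \<partial>count_space UNIV) =
      (\<integral>\<^sup>+V. \<integral>\<^sup>+j. ?f (j, V) \<partial>count_space UNIV \<partial>count_space UNIV)"
    unfolding nn_integral_fst_count_space nn_integral_snd_count_space ..
  also have "\<dots> = (\<integral>\<^sup>+V. ennreal ((real (card V) - 1) * osc (Phi V)) * indicator ?A V \<partial>count_space UNIV)"
  proof (rule nn_integral_cong)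
    fix V :: "int set"
    show "(\<integral>\<^sup>+j. ?f (j, V) \<partial>count_space UNIV) = ennreal ((real (card V) - 1) * osc (Phi V)) * indicator ?A V"
    proof (cases "V \<in> ?A")
      case True
      then have V: "finite V" "i \<in> V" by auto
      have "(\<integral>\<^sup>+j. ?f (j, V) \<partial>count_space UNIV) = (\<Sum>j\<in>V - {i}. ?f (j, V))"
        by (rule nn_integral_count_space') (use V in auto)
      also have "\<dots> = (\<Sum>j\<in>V - {i}. ennreal (osc (Phi V)))"
        by (rule sum.cong) (use V in auto)
      also have "\<dots> = of_nat (card V - 1) * ennreal (osc (Phi V))"
        using V by simp
      also have "\<dots> = ennreal (real (card V - 1) * osc (Phi V))"
        by (simp add: ennreal_mult' ennreal_of_nat_eq_real_of_nat)
      also have "real (card V - 1) = real (card V) - 1"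
        using V card_gt_0_iff[of V] by (subst of_nat_diff) auto
      finally show ?thesis using True by simp
    next
      case False
      then have "?f (j, V) = 0" for j by (auto split: split_indicator)
      then have "(\<integral>\<^sup>+j. ?f (j, V) \<partial>count_space UNIV) = (\<integral>\<^sup>+j. 0 \<partial>count_space (UNIV :: int set))"
        by (intro nn_integral_cong)
      with False show ?thesis by simp
    qed
  qed
  also have "\<dots> = (\<Sum>\<^sub>\<infinity>V\<in>?A. ennreal ((real (card V) - 1) * osc (Phi V)))"
  proof -
    have "countable ?A"
      by (rule countable_subset[OF _ countable_Collect_finite]) auto
    then show ?thesis
      by (simp add: infsum_ennreal_eq_nn_integral nn_integral_count_space_indicator)
  qed
  also have "ennreal (1/2) * \<dots> \<le> dobrushin Phi"
    unfolding dobrushin_def by (intro mult_left_mono SUP_upper) auto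
  finally show ?thesis .
qed

text \<open>The estimates of Dobrushin's comparison technique. The right side may be infinite, in
  which case nothing is asserted about that \<open>f\<close>.\<close>

definition estimate :: "(int \<Rightarrow> 'e) measure \<Rightarrow> (int \<Rightarrow> 'e) measure \<Rightarrow> (int \<Rightarrow> ennreal) \<Rightarrow> bool" where
  "estimate \<mu> \<nu> a \<longleftrightarrow> (\<forall>f. quasilocal f \<longrightarrow>
     ennreal \<bar>(\<integral>x. f x \<partial>\<mu>) - (\<integral>x. f x \<partial>\<nu>)\<bar> \<le> (\<integral>\<^sup>+j. a j * site_osc f j \<partial>count_space UNIV))"

lemma estimateD:
  "estimate \<mu> \<nu> a \<Longrightarrow> quasilocal f \<Longrightarrow>
     ennreal \<bar>(\<integral>x. f x \<partial>\<mu>) - (\<integral>x. f x \<partial>\<nu>)\<bar> \<le> (\<integral>\<^sup>+j. a j * site_osc f j \<partial>count_space UNIV)"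
  by (auto simp: estimate_def)

lemma estimate_mono:
  assumes "estimate \<mu> \<nu> a" "\<And>j. a j \<le> b j" shows "estimate \<mu> \<nu> b"
  unfolding estimate_def
proof (intro allI impI)
  fix f :: "(int \<Rightarrow> 'e) \<Rightarrow> real" assume "quasilocal f"
  then have "ennreal \<bar>(\<integral>x. f x \<partial>\<mu>) - (\<integral>x. f x \<partial>\<nu>)\<bar> \<le> (\<integral>\<^sup>+j. a j * site_osc f j \<partial>count_space UNIV)"
    by (rule estimateD[OF assms(1)])
  also have "\<dots> \<le> (\<integral>\<^sup>+j. b j * site_osc f j \<partial>count_space UNIV)"
    using assms(2) by (intro nn_integral_mono mult_right_mono) auto
  finally show "ennreal \<bar>(\<integral>x. f x \<partial>\<mu>) - (\<integral>x. f x \<partial>\<nu>)\<bar> \<le> (\<integral>\<^sup>+j. b j * site_osc f j \<partial>count_space UNIV)" .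
qed

text \<open>It suffices to test an estimate on local functions: truncating a quasilocal function to a large
  finite box changes it uniformly little and does not increase its site oscillations.\<close>

lemma estimateI_local:
  assumes \<mu>: "prob_space \<mu>" "sets \<mu> = sets XM" and \<nu>: "prob_space \<nu>" "sets \<nu> = sets XM"
    and loc: "\<And>S f. finite S \<Longrightarrow> depends_on S f \<Longrightarrow>
      ennreal \<bar>(\<integral>x. f x \<partial>\<mu>) - (\<integral>x. f x \<partial>\<nu>)\<bar> \<le> (\<integral>\<^sup>+j. a j * site_osc f j \<partial>count_space UNIV)"
  shows "estimate \<mu> \<nu> a"
  unfolding estimate_def
proof (intro allI impI)
  fix f :: "(int \<Rightarrow> 'e) \<Rightarrow> real" assume f: "quasilocal f"
  let ?R = "\<integral>\<^sup>+j. a j * site_osc f j \<partial>count_space UNIV"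
  show "ennreal \<bar>(\<integral>x. f x \<partial>\<mu>) - (\<integral>x. f x \<partial>\<nu>)\<bar> \<le> ?R"
  proof (rule ennreal_le_epsilon)
    fix e :: real assume e: "0 < e"
    obtain S where S: "finite S" "\<And>x y. (\<And>i. i \<in> S \<Longrightarrow> x i = y i) \<Longrightarrow> \<bar>f x - f y\<bar> \<le> e / 2"
      by (rule quasilocalD[OF f, of "e / 2"]) (use e in auto)
    define g where "g x = f (restrict x S)" for x
    have g: "depends_on S g" unfolding g_def by (rule depends_on_truncate)
    have gq: "quasilocal g" by (rule depends_on_quasilocal[OF g S(1)])
    have fg: "\<bar>f x - g x\<bar> \<le> e / 2" for x unfolding g_def by (rule S(2)) simp
    have close: "\<bar>(\<integral>x. f x \<partial>m) - (\<integral>x. g x \<partial>m)\<bar> \<le> e / 2" if m: "prob_space m" "sets m = sets XM" for m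
    proof -
      interpret m: prob_space m by fact
      note int = quasilocal_integrable[OF f m] quasilocal_integrable[OF gq m]
      have "\<bar>\<integral>x. f x - g x \<partial>m\<bar> \<le> (\<integral>x. \<bar>f x - g x\<bar> \<partial>m)" by (rule integral_abs_bound)
      also have "\<dots> \<le> (\<integral>x. e / 2 \<partial>m)" using int fg by (intro integral_mono) auto
      finally show ?thesis using int by (simp add: m.prob_space)
    qed
    have "\<bar>(\<integral>x. f x \<partial>\<mu>) - (\<integral>x. f x \<partial>\<nu>)\<bar> \<le> \<bar>(\<integral>x. g x \<partial>\<mu>) - (\<integral>x. g x \<partial>\<nu>)\<bar> + e"
      using close[OF \<mu>] close[OF \<nu>] by linarith
    then have "ennreal \<bar>(\<integral>x. f x \<partial>\<mu>) - (\<integral>x. f x \<partial>\<nu>)\<bar> \<le> ennreal (\<bar>(\<integral>x. g x \<partial>\<mu>) - (\<integral>x. g x \<partial>\<nu>)\<bar> + e)"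
      by (rule ennreal_leI)
    also have "\<dots> = ennreal \<bar>(\<integral>x. g x \<partial>\<mu>) - (\<integral>x. g x \<partial>\<nu>)\<bar> + ennreal e"
      using e by (intro ennreal_plus) auto
    also have "ennreal \<bar>(\<integral>x. g x \<partial>\<mu>) - (\<integral>x. g x \<partial>\<nu>)\<bar> \<le> (\<integral>\<^sup>+j. a j * site_osc g j \<partial>count_space UNIV)"
      by (rule loc[OF S(1) g])
    also have "\<dots> \<le> ?R"
      unfolding g_def by (intro nn_integral_mono mult_left_mono site_osc_truncate) auto
    finally show "ennreal \<bar>(\<integral>x. f x \<partial>\<mu>) - (\<integral>x. f x \<partial>\<nu>)\<bar> \<le> ?R + ennreal e"
      by (simp add: add_right_mono)
  qed
qed

lemma nn_integral_local_site_osc: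
  assumes "finite S" "depends_on S f"
  shows "(\<integral>\<^sup>+j. a j * site_osc f j \<partial>count_space UNIV) = (\<Sum>j\<in>S. a j * site_osc f j)"
  by (rule nn_integral_count_space') (use assms site_osc_depends_on in auto)

lemma estimate_one:
  assumes \<mu>: "prob_space \<mu>" "sets \<mu> = sets XM" and \<nu>: "prob_space \<nu>" "sets \<nu> = sets XM"
  shows "estimate \<mu> \<nu> (\<lambda>_. 1)"
proof (rule estimateI_local[OF \<mu> \<nu>])
  fix S and f :: "(int \<Rightarrow> 'e) \<Rightarrow> real" assume S: "finite S" and f: "depends_on S f"
  have q: "quasilocal f" by (rule depends_on_quasilocal[OF f S])
  have "ennreal \<bar>(\<integral>x. f x \<partial>\<mu>) - (\<integral>x. f x \<partial>\<nu>)\<bar> \<le> (\<Sum>j\<in>S. site_osc f j)"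
  proof (rule integral_diff_le_ennreal[OF \<mu>(1) \<nu>(1)])
    fix x y
    \<comment> \<open>\<open>f\<close> ignores sites off \<open>S\<close>, so \<open>y\<close> may
      be replaced by a configuration that differs from \<open>x\<close> only in the finite set
      \<open>S\<close>.\<close>
    have "f y = f (merge_conf S y x)" by (rule depends_onD[OF f]) simp
    then show "ennreal \<bar>f x - f y\<bar> \<le> (\<Sum>j\<in>S. site_osc f j)"
      using diff_le_sum_site_osc[OF S, of x "merge_conf S y x" f] by simp
  qed (use quasilocal_integrable[OF q] \<mu> \<nu> in auto)
  then show "ennreal \<bar>(\<integral>x. f x \<partial>\<mu>) - (\<integral>x. f x \<partial>\<nu>)\<bar> \<le>
      (\<integral>\<^sup>+j. 1 * site_osc f j \<partial>count_space UNIV)"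
    using nn_integral_local_site_osc[OF S f, of "\<lambda>_. 1"] by simp
qed

text \<open>By the Gibbs property \<open>f\<close> may be replaced by its conditional mean at site \<open>i\<close>, which has no
  oscillation at \<open>i\<close> and whose oscillation elsewhere is controlled by the Dobrushin coefficients.\<close>

lemma estimate_update:
  assumes gibbs: "is_gibbs Phi \<mu>" "is_gibbs Phi \<nu>" and est: "estimate \<mu> \<nu> a"
  shows "estimate \<mu> \<nu> (a(i := \<integral>\<^sup>+j. indicator (- {i}) j * (a j * dobrushin_coeff i j) \<partial>count_space UNIV))"
  unfolding estimate_def
proof (intro allI impI)
  fix f :: "(int \<Rightarrow> 'e) \<Rightarrow> real" assume f: "quasilocal f"
  let ?g = "spec_mean {i} f"
  let ?A = "\<integral>\<^sup>+j. indicator (- {i}) j * (a j * dobrushin_coeff i j) \<partial>count_space UNIV"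
  have "ennreal \<bar>(\<integral>x. f x \<partial>\<mu>) - (\<integral>x. f x \<partial>\<nu>)\<bar> = ennreal \<bar>(\<integral>x. ?g x \<partial>\<mu>) - (\<integral>x. ?g x \<partial>\<nu>)\<bar>"
    using gibbs_integral_spec_mean[OF gibbs(1) _ f, of "{i}"] gibbs_integral_spec_mean[OF gibbs(2) _ f, of "{i}"]
    by simp
  also have "\<dots> \<le> (\<integral>\<^sup>+j. a j * site_osc ?g j \<partial>count_space UNIV)"
    by (rule estimateD[OF est spec_mean_quasilocal[OF _ f]]) simp
  also have "\<dots> \<le> (\<integral>\<^sup>+j. indicator (- {i}) j * a j * site_osc f j +
      indicator (- {i}) j * (a j * dobrushin_coeff i j) * site_osc f i \<partial>count_space UNIV)"
  proof (rule nn_integral_mono)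
    fix j
    show "a j * site_osc ?g j \<le> indicator (- {i}) j * a j * site_osc f j +
        indicator (- {i}) j * (a j * dobrushin_coeff i j) * site_osc f i"
    proof (cases "j = i")
      case True
      then show ?thesis by (simp add: site_osc_spec_mean_self)
    next
      case False
      then have "a j * site_osc ?g j \<le> a j * (site_osc f j + dobrushin_coeff i j * site_osc f i)"
        by (intro mult_left_mono site_osc_spec_mean f) auto
      with False show ?thesis by (simp add: distrib_left mult_ac)
    qed
  qed
  also have "\<dots> = (\<integral>\<^sup>+j. indicator (- {i}) j * a j * site_osc f j \<partial>count_space UNIV) + ?A * site_osc f i"
    by (simp add: nn_integral_add nn_integral_multc)
  \<comment> \<open>Writing this product as a sum concentrated at \<open>i\<close> lets it merge
    with the sum over the other sites into one integral against the updated weights.\<close>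
  also have "?A * site_osc f i = (\<integral>\<^sup>+j. indicator {i} j * (?A * site_osc f i) \<partial>count_space UNIV)"
    by (subst nn_integral_count_space'[of "{i}"]) auto
  also have "(\<integral>\<^sup>+j. indicator (- {i}) j * a j * site_osc f j \<partial>count_space UNIV) + \<dots> =
      (\<integral>\<^sup>+j. indicator (- {i}) j * a j * site_osc f j + indicator {i} j * (?A * site_osc f i) \<partial>count_space UNIV)"
    by (rule nn_integral_add[symmetric]) auto
  also have "\<dots> = (\<integral>\<^sup>+j. (a(i := ?A)) j * site_osc f j \<partial>count_space UNIV)"
    by (rule nn_integral_cong) (auto split: split_indicator)
  finally show "ennreal \<bar>(\<integral>x. f x \<partial>\<mu>) - (\<integral>x. f x \<partial>\<nu>)\<bar> \<le>
      (\<integral>\<^sup>+j. (a(i := ?A)) j * site_osc f j \<partial>count_space UNIV)" .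
qed

text \<open>Sites are updated successively. Each update leaves the weights already lowered
  untouched, and since the Dobrushin constant is at most 1 all current weights stay below
  \<open>K\<close>, so the row sum bound gives the same new value every time.\<close>

lemma estimate_finite_update:
  assumes gibbs: "is_gibbs Phi \<mu>" "is_gibbs Phi \<nu>" and est: "estimate \<mu> \<nu> (\<lambda>_. K)"
    and d1: "dobrushin Phi \<le> 1" and S: "finite S"
  shows "estimate \<mu> \<nu> (\<lambda>j. if j \<in> S then dobrushin Phi * K else K)"
  using S
proof (induction S)
  case empty
  then show ?case using est by simp
next
  case (insert i S)
  let ?a = "\<lambda>j. if j \<in> S then dobrushin Phi * K else K"
  let ?A = "\<integral>\<^sup>+j. indicator (- {i}) j * (?a j * dobrushin_coeff i j) \<partial>count_space UNIV"
  have aK: "?a j \<le> K" for j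
    using mult_right_mono[OF d1, of K] by simp
  have "?A \<le> (\<integral>\<^sup>+j. K * (indicator (- {i}) j * dobrushin_coeff i j) \<partial>count_space UNIV)"
  proof (rule nn_integral_mono)
    fix j
    have "indicator (- {i}) j * (?a j * dobrushin_coeff i j) \<le> indicator (- {i}) j * (K * dobrushin_coeff i j)"
      by (intro mult_left_mono mult_right_mono aK) auto
    then show "indicator (- {i}) j * (?a j * dobrushin_coeff i j) \<le> K * (indicator (- {i}) j * dobrushin_coeff i j)"
      by (simp add: mult_ac)
  qed
  also have "\<dots> = K * (\<integral>\<^sup>+j. indicator (- {i}) j * dobrushin_coeff i j \<partial>count_space UNIV)"
    by (simp add: nn_integral_cmult)
  also have "\<dots> \<le> K * dobrushin Phi"
    by (intro mult_left_mono dobrushin_coeff_sum) auto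
  finally have A: "?A \<le> dobrushin Phi * K" by (simp add: mult.commute)
  have "estimate \<mu> \<nu> (?a(i := ?A))" by (rule estimate_update[OF gibbs insert.IH])
  then show ?case
  proof (rule estimate_mono)
    fix j
    show "(?a(i := ?A)) j \<le> (if j \<in> insert i S then dobrushin Phi * K else K)"
      using A by simp
  qed
qed

text \<open>For a local function, updating the sites of its own finite support \<open>S\<close> is
  as good as updating all sites; \<open>estimateI_local\<close> then passes to quasilocal
  functions.\<close>

lemma estimate_contract:
  assumes gibbs: "is_gibbs Phi \<mu>" "is_gibbs Phi \<nu>" and est: "estimate \<mu> \<nu> (\<lambda>_. K)"
    and d1: "dobrushin Phi \<le> 1"
  shows "estimate \<mu> \<nu> (\<lambda>_. dobrushin Phi * K)"
proof (rule estimateI_local)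
  fix S and f :: "(int \<Rightarrow> 'e) \<Rightarrow> real" assume S: "finite S" and f: "depends_on S f"
  have "ennreal \<bar>(\<integral>x. f x \<partial>\<mu>) - (\<integral>x. f x \<partial>\<nu>)\<bar> \<le>
      (\<integral>\<^sup>+j. (if j \<in> S then dobrushin Phi * K else K) * site_osc f j \<partial>count_space UNIV)"
    by (rule estimateD[OF estimate_finite_update[OF gibbs est d1 S] depends_on_quasilocal[OF f S]])
  also have "\<dots> = (\<integral>\<^sup>+j. dobrushin Phi * K * site_osc f j \<partial>count_space UNIV)"
    unfolding nn_integral_local_site_osc[OF S f] by (rule sum.cong) auto
  finally show "ennreal \<bar>(\<integral>x. f x \<partial>\<mu>) - (\<integral>x. f x \<partial>\<nu>)\<bar> \<le>
      (\<integral>\<^sup>+j. dobrushin Phi * K * site_osc f j \<partial>count_space UNIV)" .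
qed (fact is_gibbs_prob_space[OF gibbs(1)] is_gibbs_sets[OF gibbs(1)]
    is_gibbs_prob_space[OF gibbs(2)] is_gibbs_sets[OF gibbs(2)])+

lemma gibbs_integral_unique:
  fixes f :: "(int \<Rightarrow> 'e) \<Rightarrow> real"
  assumes gibbs: "is_gibbs Phi \<mu>" "is_gibbs Phi \<nu>" and d1: "dobrushin Phi < 1"
    and S: "finite S" and f: "depends_on S f"
  shows "(\<integral>x. f x \<partial>\<mu>) = (\<integral>x. f x \<partial>\<nu>)"
proof -
  have q: "quasilocal f" by (rule depends_on_quasilocal[OF f S])
  have est: "estimate \<mu> \<nu> (\<lambda>_. dobrushin Phi ^ n)" for n
  proof (induction n)
    case 0
    show ?case
      using estimate_one[OF is_gibbs_prob_space[OF gibbs(1)] is_gibbs_sets[OF gibbs(1)]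
          is_gibbs_prob_space[OF gibbs(2)] is_gibbs_sets[OF gibbs(2)]] by simp
  next
    case (Suc n)
    then show ?case using estimate_contract[OF gibbs Suc] d1 by simp
  qed
  define c where "c = enn2real (dobrushin Phi)"
  have c: "dobrushin Phi = ennreal c" "0 \<le> c" "c < 1"
  proof -
    have "dobrushin Phi < top" using d1 by (rule less_trans) simp
    then show eq: "dobrushin Phi = ennreal c" by (simp add: c_def)
    show "0 \<le> c" by (simp add: c_def)
    then show "c < 1" using d1 unfolding eq by simp
  qed
  \<comment> \<open>The total oscillation of a local function is finite, so the bounds
    \<open>c ^ n * T\<close> tend to 0.\<close>
  define T where "T = enn2real (\<Sum>j\<in>S. site_osc f j)"
  have T: "(\<Sum>j\<in>S. site_osc f j) = ennreal T" "0 \<le> T"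
    using site_osc_finite[OF q] S by (auto simp: T_def)
  have "\<bar>(\<integral>x. f x \<partial>\<mu>) - (\<integral>x. f x \<partial>\<nu>)\<bar> \<le> c ^ n * T" for n
  proof -
    have "ennreal \<bar>(\<integral>x. f x \<partial>\<mu>) - (\<integral>x. f x \<partial>\<nu>)\<bar> \<le>
        (\<integral>\<^sup>+j. dobrushin Phi ^ n * site_osc f j \<partial>count_space UNIV)"
      by (rule estimateD[OF est q])
    also have "\<dots> = dobrushin Phi ^ n * (\<Sum>j\<in>S. site_osc f j)"
      unfolding nn_integral_local_site_osc[OF S f] by (simp add: sum_distrib_left)
    also have "\<dots> = ennreal (c ^ n * T)"
      unfolding T(1) c(1) using c T by (simp add: ennreal_mult ennreal_power)
    finally show ?thesis using c T by simp
  qed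
  moreover have "(\<lambda>n. c ^ n * T) \<longlonglongrightarrow> 0"
    using c by (intro tendsto_mult_left_zero LIMSEQ_realpow_zero)
  ultimately have "\<bar>(\<integral>x. f x \<partial>\<mu>) - (\<integral>x. f x \<partial>\<nu>)\<bar> \<le> 0"
    by (intro LIMSEQ_le_const[of "\<lambda>n. c ^ n * T"]) auto
  then show ?thesis by simp
qed

theorem gibbs_unique:
  assumes gibbs: "is_gibbs Phi \<mu>" "is_gibbs Phi \<nu>" and d1: "dobrushin Phi < 1"
  shows "\<mu> = \<nu>"
proof (rule measure_eqI_PiM_infinite[where I = UNIV and M = "\<lambda>_. count_space UNIV"])
  interpret \<mu>: prob_space \<mu> by (rule is_gibbs_prob_space[OF gibbs(1)])
  interpret \<nu>: prob_space \<nu> by (rule is_gibbs_prob_space[OF gibbs(2)])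
  show "finite_measure \<mu>" by unfold_locales
  show sets: "sets \<mu> = sets (PiM UNIV (\<lambda>_. count_space UNIV))" "sets \<nu> = sets (PiM UNIV (\<lambda>_. count_space UNIV))"
    using is_gibbs_sets[OF gibbs(1)] is_gibbs_sets[OF gibbs(2)] by (simp_all add: XM_def)
  fix A :: "int \<Rightarrow> 'e set" and J :: "int set" assume J: "finite J"
  let ?X = "prod_emb UNIV (\<lambda>_. count_space UNIV) J (Pi\<^sub>E J A)"
  have X: "?X = {x. \<forall>i\<in>J. x i \<in> A i}"
    by (auto simp: prod_emb_def PiE_def Pi_iff)
  have m: "?X \<in> sets (PiM UNIV (\<lambda>_. count_space UNIV))"
    using J by (intro sets_PiM_I) auto
  \<comment> \<open>Cylinder events determine the measure, and their indicators are local
    functions.\<close>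
  have "depends_on J (indicator ?X :: _ \<Rightarrow> real)"
    unfolding X by (auto simp: depends_on_def indicator_def)
  from gibbs_integral_unique[OF gibbs d1 J this]
  have "measure \<mu> ?X = measure \<nu> ?X" using m sets by simp
  then show "emeasure \<mu> ?X = emeasure \<nu> ?X"
    by (simp add: \<mu>.emeasure_eq_measure \<nu>.emeasure_eq_measure)
qed

end

subsection \<open>Finite perturbations\<close>

lemma (in prob_space) integral_exp_pos:
  fixes W :: "'a \<Rightarrow> real"
  assumes "integrable M (\<lambda>x. exp (W x))"
  shows "0 < (\<integral>x. exp (W x) \<partial>M)"
proof -
  have "(\<integral>x. exp (W x) \<partial>M) \<noteq> 0"
  proof
    assume "(\<integral>x. exp (W x) \<partial>M) = 0"
    then have "AE x in M. exp (W x) = 0"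
      using assms by (subst (asm) integral_nonneg_eq_0_iff_AE) auto
    then have "AE x in M. False" by simp
    then show False by simp
  qed
  moreover have "0 \<le> (\<integral>x. exp (W x) \<partial>M)" by (rule integral_nonneg_AE) simp
  ultimately show ?thesis by linarith
qed

text \<open>\<open>rel\<close> says that \<open>W\<close> and the Hamiltonian difference agree up to
  a function of the exterior of \<open>L\<close>. With \<open>s\<close> the conditional mean of the
  density \<open>r\<close>, the \<open>Phi\<close>-kernel weighted by \<open>r\<close> is the
  \<open>Phi'\<close>-kernel times \<open>s\<close>; the Gibbs property of \<mu>, read once in each
  direction, converts this into the Gibbs property of the tilted measure.\<close>

lemma gibbs_density_perturbation:
  fixes Phi Phi' :: "int set \<Rightarrow> (int \<Rightarrow> 'e::finite) \<Rightarrow> real" and W :: "(int \<Rightarrow> 'e) \<Rightarrow> real"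
  assumes "uac_interaction Phi" "uac_interaction Phi'"
    and gibbs: "is_gibbs Phi \<mu>"
    and W: "depends_on T W" "finite T"
    and rel: "\<And>L x y. finite L \<Longrightarrow> (\<And>i. i \<notin> L \<Longrightarrow> x i = y i) \<Longrightarrow>
      hamiltonian Phi' L x - hamiltonian Phi L x - W x = hamiltonian Phi' L y - hamiltonian Phi L y - W y"
  shows "is_gibbs Phi' (density \<mu> (\<lambda>x. ennreal (exp (- W x) / (\<integral>y. exp (- W y) \<partial>\<mu>))))"
proof -
  interpret Phi: uac_interaction Phi by fact
  interpret Phi': uac_interaction Phi' by fact
  have sets [measurable_cong]: "sets \<mu> = sets XM" by (rule is_gibbs_sets[OF gibbs])
  have space [simp]: "space \<mu> = UNIV" using sets_eq_imp_space_eq[OF sets] by simp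
  interpret prob_space \<mu> by (rule is_gibbs_prob_space[OF gibbs])
  have "depends_on T (\<lambda>x. exp (- W x))"
    using W(1) by (simp add: depends_on_def)
  then have q: "quasilocal (\<lambda>x. exp (- W x))" by (rule depends_on_quasilocal[OF _ W(2)])
  note int = quasilocal_integrable[OF q prob_space_axioms sets]
  have [measurable]: "W \<in> borel_measurable XM" by (rule depends_on_measurable[OF W])
  define Z where "Z = (\<integral>y. exp (- W y) \<partial>\<mu>)"
  have Z: "Z > 0" unfolding Z_def by (rule integral_exp_pos[OF int])
  define r where "r x = exp (- W x) / Z" for x
  have r0: "0 \<le> r x" for x using Z by (simp add: r_def)
  have [measurable]: "r \<in> borel_measurable XM" unfolding r_def by measurable
  let ?\<nu> = "density \<mu> (\<lambda>x. ennreal (r x))"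
  have "emeasure ?\<nu> (space ?\<nu>) = (\<integral>\<^sup>+x. ennreal (r x) \<partial>\<mu>)"
    by (subst emeasure_density) (use sets.top[of \<mu>] in auto)
  also have "\<dots> = ennreal (\<integral>x. r x \<partial>\<mu>)"
    using r0 int by (intro nn_integral_eq_integral) (auto simp: r_def)
  also have "(\<integral>x. r x \<partial>\<mu>) = 1" using Z unfolding r_def by (simp add: Z_def)
  finally have prob: "prob_space ?\<nu>" by (intro prob_spaceI) simp
  then interpret \<nu>: prob_space ?\<nu> .
  have "measure ?\<nu> A = (\<integral>\<eta>. (\<Sum>\<sigma>\<in>local_conf L. gibbs_spec Phi' L \<sigma> \<eta> * indicator A (merge_conf L \<sigma> \<eta>)) \<partial>?\<nu>)"
    if L: "finite L" and A[measurable]: "A \<in> sets XM" for L A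
  proof -
    note [measurable] = Phi.gibbs_spec_measurable[OF L] Phi'.gibbs_spec_measurable[OF L]
    define g where "g \<eta> = (\<Sum>\<sigma>\<in>local_conf L. gibbs_spec Phi' L \<sigma> \<eta> * indicator A (merge_conf L \<sigma> \<eta>))" for \<eta>
    define s where "s \<eta> = (\<Sum>\<tau>\<in>local_conf L. gibbs_spec Phi L \<tau> \<eta> * r (merge_conf L \<tau> \<eta>))" for \<eta>
    have g[measurable]: "g \<in> borel_measurable XM" unfolding g_def by measurable
    have g0: "0 \<le> g \<eta>" for \<eta>
      unfolding g_def using Phi'.gibbs_spec_nonneg by (intro sum_nonneg) auto
    have s0: "0 \<le> s \<eta>" for \<eta>
      unfolding s_def using Phi.gibbs_spec_nonneg r0 by (intro sum_nonneg) auto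
    have g_merge: "g (merge_conf L \<tau> \<eta>) = g \<eta>" for \<tau> \<eta>
      by (simp add: g_def gibbs_spec_def)
    \<comment> \<open>By \<open>rel\<close>, \<open>r\<close> equals \<open>exp (H - H')\<close> up to a factor constant on the fibre of configurations that
      agree off \<open>L\<close>, and this factor cancels on normalisation.\<close>
    have tilt: "gibbs_spec Phi L \<sigma> \<eta> * r (merge_conf L \<sigma> \<eta>) = gibbs_spec Phi' L \<sigma> \<eta> * s \<eta>" for \<sigma> \<eta>
    proof -
      define h where "h \<sigma> = hamiltonian Phi L (merge_conf L \<sigma> \<eta>)" for \<sigma>
      define h' where "h' \<sigma> = hamiltonian Phi' L (merge_conf L \<sigma> \<eta>)" for \<sigma>
      define N where "N = (\<Sum>\<tau>\<in>local_conf L. exp (- h \<tau>))"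
      define N' where "N' = (\<Sum>\<tau>\<in>local_conf L. exp (- h' \<tau>))"
      have N': "N' > 0" unfolding N'_def h'_def by (rule Phi'.partition_pos[OF L])
      define c where "c = h' \<sigma> - h \<sigma> - W (merge_conf L \<sigma> \<eta>)"
      have "h' \<tau> - h \<tau> - W (merge_conf L \<tau> \<eta>) = c" for \<tau>
        unfolding h_def h'_def c_def by (rule rel[OF L]) simp
      then have "- h \<tau> + - W (merge_conf L \<tau> \<eta>) = c + - h' \<tau>" for \<tau>
        by (simp add: algebra_simps)
      then have e: "exp (- h \<tau>) * exp (- W (merge_conf L \<tau> \<eta>)) = exp c * exp (- h' \<tau>)" for \<tau>
        unfolding exp_add[symmetric] by simp
      have 1: "gibbs_spec Phi L \<tau> \<eta> * r (merge_conf L \<tau> \<eta>) = exp c / (N * Z) * exp (- h' \<tau>)" for \<tau>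
      proof -
        have "gibbs_spec Phi L \<tau> \<eta> * r (merge_conf L \<tau> \<eta>) = (exp (- h \<tau>) * exp (- W (merge_conf L \<tau> \<eta>))) / (N * Z)"
          by (simp add: gibbs_spec_def r_def h_def N_def)
        then show ?thesis unfolding e by simp
      qed
      have "s \<eta> = exp c / (N * Z) * N'"
        unfolding s_def 1 N'_def by (simp add: sum_distrib_left)
      then show ?thesis
        unfolding 1 using N' by (simp add: gibbs_spec_def h'_def N'_def)
    qed
    have "emeasure ?\<nu> A = (\<integral>\<^sup>+x. ennreal (r x) * indicator A x \<partial>\<mu>)"
      by (rule emeasure_density) auto
    also have "\<dots> = (\<integral>\<^sup>+\<eta>. (\<Sum>\<sigma>\<in>local_conf L. ennreal (gibbs_spec Phi L \<sigma> \<eta>) *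
        (ennreal (r (merge_conf L \<sigma> \<eta>)) * indicator A (merge_conf L \<sigma> \<eta>))) \<partial>\<mu>)"
      by (rule Phi.gibbs_nn_integral[OF gibbs L]) simp
    also have "\<dots> = (\<integral>\<^sup>+\<eta>. ennreal (s \<eta> * g \<eta>) \<partial>\<mu>)"
    proof (rule nn_integral_cong)
      fix \<eta>
      have "(\<Sum>\<sigma>\<in>local_conf L. ennreal (gibbs_spec Phi L \<sigma> \<eta>) *
          (ennreal (r (merge_conf L \<sigma> \<eta>)) * indicator A (merge_conf L \<sigma> \<eta>))) =
        (\<Sum>\<sigma>\<in>local_conf L. ennreal (gibbs_spec Phi L \<sigma> \<eta> * r (merge_conf L \<sigma> \<eta>) * indicator A (merge_conf L \<sigma> \<eta>)))"
        using Phi.gibbs_spec_nonneg r0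
        by (intro sum.cong refl) (simp add: ennreal_mult ennreal_indicator[symmetric] mult_ac)
      also have "\<dots> = ennreal (\<Sum>\<sigma>\<in>local_conf L. gibbs_spec Phi L \<sigma> \<eta> * r (merge_conf L \<sigma> \<eta>) * indicator A (merge_conf L \<sigma> \<eta>))"
        using Phi.gibbs_spec_nonneg r0 by (intro sum_ennreal) auto
      also have "(\<Sum>\<sigma>\<in>local_conf L. gibbs_spec Phi L \<sigma> \<eta> * r (merge_conf L \<sigma> \<eta>) * indicator A (merge_conf L \<sigma> \<eta>)) = s \<eta> * g \<eta>"
        unfolding tilt g_def sum_distrib_left by (intro sum.cong) auto
      finally show "(\<Sum>\<sigma>\<in>local_conf L. ennreal (gibbs_spec Phi L \<sigma> \<eta>) *
          (ennreal (r (merge_conf L \<sigma> \<eta>)) * indicator A (merge_conf L \<sigma> \<eta>))) = ennreal (s \<eta> * g \<eta>)" .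
    qed
    \<comment> \<open>The way back: \<open>g\<close> does not see the spins in \<open>L\<close>, so
      it may be moved inside the mean that defines \<open>s\<close>, and the Gibbs property of \<mu>
      folds the kernel up again.\<close>
    also have "\<dots> = (\<integral>\<^sup>+\<eta>. (\<Sum>\<sigma>\<in>local_conf L. ennreal (gibbs_spec Phi L \<sigma> \<eta>) *
        (ennreal (r (merge_conf L \<sigma> \<eta>)) * ennreal (g (merge_conf L \<sigma> \<eta>)))) \<partial>\<mu>)"
    proof (rule nn_integral_cong)
      fix \<eta>
      have "(\<Sum>\<sigma>\<in>local_conf L. ennreal (gibbs_spec Phi L \<sigma> \<eta>) *
          (ennreal (r (merge_conf L \<sigma> \<eta>)) * ennreal (g (merge_conf L \<sigma> \<eta>)))) =
        (\<Sum>\<sigma>\<in>local_conf L. ennreal (gibbs_spec Phi L \<sigma> \<eta> * r (merge_conf L \<sigma> \<eta>))) * ennreal (g \<eta>)"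
        unfolding g_merge sum_distrib_right using Phi.gibbs_spec_nonneg r0
        by (intro sum.cong refl) (simp add: ennreal_mult mult_ac)
      also have "(\<Sum>\<sigma>\<in>local_conf L. ennreal (gibbs_spec Phi L \<sigma> \<eta> * r (merge_conf L \<sigma> \<eta>))) = ennreal (s \<eta>)"
        unfolding s_def using Phi.gibbs_spec_nonneg r0 by (intro sum_ennreal) auto
      finally show "ennreal (s \<eta> * g \<eta>) = (\<Sum>\<sigma>\<in>local_conf L. ennreal (gibbs_spec Phi L \<sigma> \<eta>) *
          (ennreal (r (merge_conf L \<sigma> \<eta>)) * ennreal (g (merge_conf L \<sigma> \<eta>))))"
        using s0 g0 by (simp add: ennreal_mult)
    qed
    also have "\<dots> = (\<integral>\<^sup>+x. ennreal (r x) * ennreal (g x) \<partial>\<mu>)"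
      by (rule Phi.gibbs_nn_integral[OF gibbs L, symmetric]) simp
    also have "\<dots> = (\<integral>\<^sup>+x. ennreal (g x) \<partial>?\<nu>)"
      by (rule nn_integral_density[symmetric]) auto
    finally have "measure ?\<nu> A = enn2real (\<integral>\<^sup>+x. ennreal (g x) \<partial>?\<nu>)"
      by (simp add: measure_def)
    also have "\<dots> = (\<integral>x. g x \<partial>?\<nu>)"
      by (rule integral_eq_nn_integral[symmetric]) (use g0 in auto)
    finally show ?thesis unfolding g_def .
  qed
  then have "is_gibbs Phi' ?\<nu>"
    unfolding is_gibbs_def using prob sets by simp
  then show ?thesis unfolding r_def Z_def .
qed

section \<open>The truncated interactions \<open>Psi\<close>\<close>

lemma Psi_cases: "Psi Phi Lam k V = Phi V \<or> Psi Phi Lam k V = (\<lambda>_. 0)"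
  by (simp add: Psi_def)

lemma dobrushin_mono:
  assumes "\<And>V. finite V \<Longrightarrow> V \<noteq> {} \<Longrightarrow> osc (Phi V) \<le> osc (Phi' V)"
  shows "dobrushin Phi \<le> dobrushin Phi'"
  unfolding dobrushin_def
proof (rule mult_left_mono, rule SUP_mono', rule infsum_mono)
  fix i :: int and V :: "int set" assume V: "V \<in> {L. finite L \<and> i \<in> L}"
  then have "1 \<le> real (card V)" using card_gt_0_iff[of V] by auto
  then show "ennreal ((real (card V) - 1) * osc (Phi V)) \<le> ennreal ((real (card V) - 1) * osc (Phi' V))"
    using V by (intro ennreal_leI mult_left_mono assms) auto
qed (auto intro!: nonneg_summable_on_complete)

context uac_interaction
begin

lemma supnorm_nonneg: "finite V \<Longrightarrow> 0 \<le> supnorm (Phi V)"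
  using Phi_le_supnorm[of V undefined] by linarith

lemma Psi_uac_interaction: "uac_interaction (Psi Phi Lam k)"
proof
  show "is_interaction (Psi Phi Lam k)"
    using interaction by (auto simp: is_interaction_def Psi_def)
  have le: "\<bar>supnorm (Psi Phi Lam k V)\<bar> \<le> supnorm (Phi V)" if "finite V" for V
    using Psi_cases[of Phi Lam k V] supnorm_nonneg[OF that] by auto
  obtain C where C: "\<And>i. (\<lambda>V. supnorm (Phi V)) summable_on {V. finite V \<and> i \<in> V}"
      "\<And>i. (\<Sum>\<^sub>\<infinity>V\<in>{V. finite V \<and> i \<in> V}. supnorm (Phi V)) \<le> C"
    using uac unfolding uac_def by auto
  have "(\<lambda>V. supnorm (Psi Phi Lam k V)) summable_on {V. finite V \<and> i \<in> V} \<and>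
      (\<Sum>\<^sub>\<infinity>V\<in>{V. finite V \<and> i \<in> V}. supnorm (Psi Phi Lam k V)) \<le> C" for i
    using summable_on_abs_le(1,2)[OF C(1)[of i], of "\<lambda>V. supnorm (Psi Phi Lam k V)"] le C(2)[of i] by force
  then show "uac (Psi Phi Lam k)" unfolding uac_def by blast
qed

lemma dobrushin_Psi_le: "dobrushin (Psi Phi Lam k) \<le> dobrushin Phi"
proof (rule dobrushin_mono)
  fix V :: "int set" assume "finite V"
  from osc_nonneg[OF this] show "osc (Psi Phi Lam k V) \<le> osc (Phi V)"
    using Psi_cases[of Phi Lam k V] by auto
qed

text \<open>The two interactions can differ only on \<open>Lam 1\<close>, ..., \<open>Lam k\<close>,
  and of these only sets meeting \<open>L\<close> enter the Hamiltonian. Injectivity ensures that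
  none of them reappears among the dropped sets, and turns the sum over sets into one over
  indices.\<close>

lemma hamiltonian_Psi_diff:
  assumes inj: "inj_on Lam {1..}" and fin: "\<And>i. 1 \<le> i \<Longrightarrow> finite (Lam i)" and L: "finite L"
  shows "hamiltonian (Psi Phi Lam k) L x - hamiltonian (Psi Phi Lam 0) L x =
    (\<Sum>i\<in>{i\<in>{1..k}. Lam i \<inter> L \<noteq> {}}. Phi (Lam i) x)"
proof -
  interpret k: uac_interaction "Psi Phi Lam k" by (rule Psi_uac_interaction)
  interpret zero: uac_interaction "Psi Phi Lam 0" by (rule Psi_uac_interaction)
  let ?I = "{V. finite V \<and> V \<inter> L \<noteq> {}}" and ?J = "{i\<in>{1..k}. Lam i \<inter> L \<noteq> {}}"
  have notin: "Lam i \<notin> Lam ` {k+1..}" if "i \<in> {1..k}" for i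
  proof
    assume "Lam i \<in> Lam ` {k+1..}"
    then obtain j where j: "j \<in> {k+1..}" "Lam i = Lam j" by auto
    have "i = j" by (rule inj_onD[OF inj j(2)]) (use that j(1) in auto)
    with that j(1) show False by auto
  qed
  \<comment> \<open>The enumeration starts at 1, so \<open>Psi Phi Lam 0\<close> drops all
    enumerated sets. The unreduced \<open>0+1\<close> matches the unfolded
    \<open>Psi_def\<close>.\<close>
  have img: "Lam ` {0+1..} = Lam ` {1..k} \<union> Lam ` {k+1..}"
    unfolding image_Un[symmetric] by (rule arg_cong[where f = "image Lam"]) auto
  have "hamiltonian (Psi Phi Lam k) L x - hamiltonian (Psi Phi Lam 0) L x =
      (\<Sum>\<^sub>\<infinity>V\<in>?I. Psi Phi Lam k V x - Psi Phi Lam 0 V x)"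
    unfolding hamiltonian_def using k.Phi_summable[OF L, of x] zero.Phi_summable[OF L, of x]
    by (simp add: infsum_diff_real)
  also have "\<dots> = (\<Sum>\<^sub>\<infinity>V\<in>Lam ` ?J. Phi V x)"
  proof (rule infsum_cong_neutral)
    fix V assume "V \<in> ?I - Lam ` ?J"
    then have "V \<notin> Lam ` {1..k}" by auto
    then show "Psi Phi Lam k V x - Psi Phi Lam 0 V x = 0"
      unfolding Psi_def img by auto
  next
    fix V assume "V \<in> Lam ` ?J - ?I"
    then show "Phi V x = 0" using fin by auto
  next
    fix V assume "V \<in> ?I \<inter> Lam ` ?J"
    then obtain i where "i \<in> {1..k}" "V = Lam i" by auto
    then show "Psi Phi Lam k V x - Psi Phi Lam 0 V x = Phi V x"
      using notin unfolding Psi_def img by auto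
  qed
  also have "\<dots> = (\<Sum>V\<in>Lam ` ?J. Phi V x)" by simp
  also have "\<dots> = (\<Sum>i\<in>?J. Phi (Lam i) x)"
    by (rule sum.reindex_cong[OF inj_on_subset[OF inj]]) auto
  finally show ?thesis .
qed

lemma gibbs_Psi_density:
  assumes Lam: "bij_betw Lam {1..} crossing_sets" and gibbs: "is_gibbs (Psi Phi Lam 0) \<nu>0"
  shows "is_gibbs (Psi Phi Lam k) (density \<nu>0 (\<lambda>x. ennreal (exp (- (\<Sum>i=1..k. Phi (Lam i) x)) /
                 (\<integral>y. exp (- (\<Sum>i=1..k. Phi (Lam i) y)) \<partial>\<nu>0))))"
proof (rule gibbs_density_perturbation[OF Psi_uac_interaction Psi_uac_interaction gibbs])
  have inj: "inj_on Lam {1..}" using Lam by (rule bij_betw_imp_inj_on)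
  have fin: "finite (Lam i)" if "1 \<le> i" for i
    using bij_betwE[OF Lam] that by (auto simp: crossing_sets_def)
  show "finite (\<Union>i\<in>{1..k}. Lam i)" using fin by auto
  show "depends_on (\<Union>i\<in>{1..k}. Lam i) (\<lambda>x. \<Sum>i=1..k. Phi (Lam i) x)"
    unfolding depends_on_def
  proof (intro allI impI sum.cong refl)
    fix x y :: "int \<Rightarrow> 'e" and i assume "\<forall>j\<in>\<Union>i\<in>{1..k}. Lam i. x j = y j" "i \<in> {1..k}"
    then show "Phi (Lam i) x = Phi (Lam i) y"
      by (intro depends_onD[OF Phi_depends_on] fin) auto
  qed
  fix L and x y :: "int \<Rightarrow> 'e" assume L: "finite L" and xy: "\<And>i. i \<notin> L \<Longrightarrow> x i = y i"
  let ?D = "\<lambda>x. hamiltonian (Psi Phi Lam k) L x - hamiltonian (Psi Phi Lam 0) L x - (\<Sum>i=1..k. Phi (Lam i) x)"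
  \<comment> \<open>What remains are the terms of \<open>W\<close> whose sets miss \<open>L\<close>.
    They see only sites where \<open>x\<close> and \<open>y\<close> agree, which is the invariance
    required of the perturbation.\<close>
  have D: "?D x = - (\<Sum>i\<in>{i\<in>{1..k}. Lam i \<inter> L = {}}. Phi (Lam i) x)" for x
  proof -
    have split: "{1..k} = {i\<in>{1..k}. Lam i \<inter> L \<noteq> {}} \<union> {i\<in>{1..k}. Lam i \<inter> L = {}}" by auto
    have "(\<Sum>i=1..k. Phi (Lam i) x) = (\<Sum>i\<in>{i\<in>{1..k}. Lam i \<inter> L \<noteq> {}} \<union> {i\<in>{1..k}. Lam i \<inter> L = {}}. Phi (Lam i) x)"
      by (rule sum.cong[OF split refl])
    also have "\<dots> = (\<Sum>i\<in>{i\<in>{1..k}. Lam i \<inter> L \<noteq> {}}. Phi (Lam i) x) + (\<Sum>i\<in>{i\<in>{1..k}. Lam i \<inter> L = {}}. Phi (Lam i) x)"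
      by (rule sum.union_disjoint) auto
    finally show ?thesis by (simp add: hamiltonian_Psi_diff[OF inj fin L])
  qed
  have "(\<Sum>i\<in>{i\<in>{1..k}. Lam i \<inter> L = {}}. Phi (Lam i) x) = (\<Sum>i\<in>{i\<in>{1..k}. Lam i \<inter> L = {}}. Phi (Lam i) y)"
  proof (rule sum.cong[OF refl])
    fix i assume "i \<in> {i\<in>{1..k}. Lam i \<inter> L = {}}"
    then show "Phi (Lam i) x = Phi (Lam i) y"
      by (intro depends_onD[OF Phi_depends_on] fin xy) auto
  qed
  then show "?D x = ?D y" unfolding D by simp
qed

end

text \<open>The factors \<open>exp (W x)\<close> and \<open>exp (- W x)\<close> cancel, so the
  normalising constant under \<open>N\<close> is \<open>1 / Z\<close> and the product of the two
  densities is 1.\<close>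

lemma density_exp_inverse:
  fixes W :: "'a \<Rightarrow> real"
  assumes "prob_space M" and W: "W \<in> borel_measurable M" and int: "integrable M (\<lambda>x. exp (- W x))"
    and N: "N = density M (\<lambda>x. ennreal (exp (- W x) / (\<integral>y. exp (- W y) \<partial>M)))"
  shows "M = density N (\<lambda>x. ennreal (exp (W x) / (\<integral>y. exp (W y) \<partial>N)))"
proof -
  interpret prob_space M by fact
  note [measurable] = W
  define Z where "Z = (\<integral>y. exp (- W y) \<partial>M)"
  have Z: "0 < Z" unfolding Z_def by (rule integral_exp_pos[OF int])
  have N': "N = density M (\<lambda>x. ennreal (exp (- W x) / Z))" unfolding N Z_def ..
  have e: "exp (- W x) * exp (W x) = 1" for x by (simp add: exp_minus)
  have "(\<integral>y. exp (W y) \<partial>N) = (\<integral>y. exp (- W y) / Z * exp (W y) \<partial>M)"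
    unfolding N' using Z by (subst integral_density) auto
  also have "\<dots> = 1 / Z" by (simp add: e prob_space)
  finally have I: "(\<integral>y. exp (W y) \<partial>N) = 1 / Z" .
  have "density N (\<lambda>x. ennreal (exp (W x) / (1 / Z))) =
      density M (\<lambda>x. ennreal (exp (- W x) / Z) * ennreal (exp (W x) / (1 / Z)))"
    unfolding N' by (rule density_density_eq) auto
  also have "(\<lambda>x. ennreal (exp (- W x) / Z) * ennreal (exp (W x) / (1 / Z))) = (\<lambda>_. 1)"
  proof
    fix x
    have "ennreal (exp (- W x) / Z) * ennreal (exp (W x) / (1 / Z)) =
        ennreal (exp (- W x) / Z * (exp (W x) / (1 / Z)))"
      using Z by (intro ennreal_mult[symmetric]) auto
    also have "exp (- W x) / Z * (exp (W x) / (1 / Z)) = 1" using Z e[of x] by simp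
    finally show "ennreal (exp (- W x) / Z) * ennreal (exp (W x) / (1 / Z)) = 1" by simp
  qed
  finally show ?thesis unfolding I by (simp add: density_1)
qed

theorem mainTheorem6:
  fixes Phi :: "int set \<Rightarrow> (int \<Rightarrow> 'e::finite) \<Rightarrow> real"
    and Lam :: "nat \<Rightarrow> int set"
  assumes "is_interaction Phi"
    and "uac Phi"
    and "dobrushin Phi < 1"
    and "bij_betw Lam {1..} crossing_sets"
  shows "(\<forall>k. dobrushin (Psi Phi Lam k) < 1) \<and>
    (\<forall>k \<nu> \<nu>0. is_gibbs (Psi Phi Lam k) \<nu> \<longrightarrow> is_gibbs (Psi Phi Lam 0) \<nu>0 \<longrightarrow>
       absolutely_continuous \<nu>0 \<nu> \<and> absolutely_continuous \<nu> \<nu>0 \<and>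
       \<nu> = density \<nu>0 (\<lambda>x. ennreal (exp (- (\<Sum>i=1..k. Phi (Lam i) x)) /
                 (\<integral>y. exp (- (\<Sum>i=1..k. Phi (Lam i) y)) \<partial>\<nu>0))) \<and>
       \<nu>0 = density \<nu> (\<lambda>x. ennreal (exp (\<Sum>i=1..k. Phi (Lam i) x) /
                 (\<integral>y. exp (\<Sum>i=1..k. Phi (Lam i) y) \<partial>\<nu>))))"
proof (intro conjI allI impI)
  interpret uac_interaction Phi using assms by unfold_locales
  show dobr: "dobrushin (Psi Phi Lam k) < 1" for k
    using dobrushin_Psi_le assms(3) by (rule le_less_trans)
  fix k and \<nu> \<nu>0 :: "(int \<Rightarrow> 'e) measure"
  assume \<nu>: "is_gibbs (Psi Phi Lam k) \<nu>" and \<nu>0: "is_gibbs (Psi Phi Lam 0) \<nu>0"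
  interpret k: uac_interaction "Psi Phi Lam k" by (rule Psi_uac_interaction)
  let ?W = "\<lambda>x. \<Sum>i=1..k. Phi (Lam i) x"
  have fin: "finite (Lam i)" if "1 \<le> i" for i
    using bij_betwE[OF assms(4)] that by (auto simp: crossing_sets_def)
  \<comment> \<open>Uniqueness for \<open>Psi Phi Lam k\<close> identifies the given \<nu> with the
    tilt of \<nu>\<open>0\<close>.\<close>
  show eq: "\<nu> = density \<nu>0 (\<lambda>x. ennreal (exp (- ?W x) / (\<integral>y. exp (- ?W y) \<partial>\<nu>0)))"
    by (rule k.gibbs_unique[OF \<nu> gibbs_Psi_density[OF assms(4) \<nu>0] dobr])
  have sets: "sets \<nu>0 = sets XM" "sets \<nu> = sets XM"
    using is_gibbs_sets[OF \<nu>0] is_gibbs_sets[OF \<nu>] .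
  have W: "?W \<in> borel_measurable XM"
    using fin by (intro borel_measurable_sum depends_on_measurable[OF Phi_depends_on]) auto
  then have W0: "?W \<in> borel_measurable \<nu>0" and W1: "?W \<in> borel_measurable \<nu>"
    using sets by (simp_all cong: measurable_cong_sets)
  have int: "integrable \<nu>0 (\<lambda>x. exp (- ?W x))"
  proof (rule quasilocal_integrable[OF _ is_gibbs_prob_space[OF \<nu>0] sets(1)])
    have "depends_on (\<Union>i\<in>{1..k}. Lam i) (\<lambda>x. exp (- ?W x))"
      unfolding depends_on_def
    proof (intro allI impI arg_cong[where f = "\<lambda>t. exp (- t)"] sum.cong refl)
      fix x y :: "int \<Rightarrow> 'e" and i assume "\<forall>j\<in>\<Union>i\<in>{1..k}. Lam i. x j = y j" "i \<in> {1..k}"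
      then show "Phi (Lam i) x = Phi (Lam i) y"
        by (intro depends_onD[OF Phi_depends_on] fin) auto
    qed
    then show "quasilocal (\<lambda>x. exp (- ?W x))"
      by (rule depends_on_quasilocal) (use fin in auto)
  qed
  show eq': "\<nu>0 = density \<nu> (\<lambda>x. ennreal (exp (?W x) / (\<integral>y. exp (?W y) \<partial>\<nu>)))"
    by (rule density_exp_inverse[OF is_gibbs_prob_space[OF \<nu>0] W0 int eq])
  show "absolutely_continuous \<nu>0 \<nu>"
    by (subst eq, rule absolutely_continuousI_density) (use W0 in measurable)
  show "absolutely_continuous \<nu> \<nu>0"
    by (subst eq', rule absolutely_continuousI_density) (use W1 in measurable)
qed

end
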